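(* A transcendental entire function $f$ is strongly polynomial-like if and only if there exists a sequence $(D_n)_{n\in\mathbb{N}}$ of bounded simply connected domains such that $\overline{D}_n\subset D_{n+1}$ for all $n\in\mathbb{N}$, $\bigcup_{n\in\mathbb{N}}D_n=\mathbb{C}$, and $f(\partial D_n)$ surrounds $\overline{D}_n$ for all $n\in\mathbb{N}$.
   Context: A polynomial-like mapping $(f;V,W)$ consists of bounded simply connected domains $V,W$ with smooth boundaries such that $\overline V\subset W$, and $f:V\to W$ is a proper analytic map of degree $d\ge 2$. A transcendental entire function $f$ is strongly polynomial-like if there exist sequences $(V_n),(W_n)$ of bounded simply connected domains with smooth boundaries such that $V_n\subset V_{n+1}$, $W_n\subset W_{n+1}$ for all $n$, $\bigcup_n V_n=\bigcup_n W_n=\mathbb{C}$, and each $(f;V_n,W_n)$ is a polynomial-like mapping. A set $S\subset\mathbb{C}$ surrounds a set $A$ if $A$ lies in a bounded component of $\mathbb{C}\setminus S$. *)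

theory Defs
  imports "HOL-Complex_Analysis.Complex_Analysis"
begin

definition domain :: "complex set \<Rightarrow> bool" where
  "domain D \<longleftrightarrow> open D \<and> connected D \<and> D \<noteq> {}"

definition iter_vderiv :: "nat \<Rightarrow> (real \<Rightarrow> complex) \<Rightarrow> real \<Rightarrow> complex" where
  "iter_vderiv n \<gamma> = ((\<lambda>g t. vector_derivative g (at t)) ^^ n) \<gamma>"

definition smooth_boundary :: "complex set \<Rightarrow> bool" where
  "smooth_boundary D \<longleftrightarrow>
     (\<exists>\<gamma>::real \<Rightarrow> complex.
        (\<forall>t. \<gamma> (t + 1) = \<gamma> t) \<and>
        (\<forall>n t. iter_vderiv n \<gamma> differentiable (at t)) \<and>
        (\<forall>t. vector_derivative \<gamma> (at t) \<noteq> 0) \<and>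
        inj_on \<gamma> {0..<1} \<and>
        frontier D = \<gamma> ` {0..1})"

definition bsc_smooth_domain :: "complex set \<Rightarrow> bool" where
  "bsc_smooth_domain D \<longleftrightarrow> domain D \<and> bounded D \<and> simply_connected D \<and> smooth_boundary D"

definition proper_map_on :: "(complex \<Rightarrow> complex) \<Rightarrow> complex set \<Rightarrow> complex set \<Rightarrow> bool" where
  "proper_map_on f V W \<longleftrightarrow> f ` V \<subseteq> W \<and>
     (\<forall>K. K \<subseteq> W \<and> compact K \<longrightarrow> compact {z \<in> V. f z \<in> K})"

definition map_degree_on :: "(complex \<Rightarrow> complex) \<Rightarrow> complex set \<Rightarrow> complex set \<Rightarrow> nat \<Rightarrow> bool" where
  "map_degree_on f V W d \<longleftrightarrow>
     (\<forall>w\<in>W. finite {z \<in> V. f z = w} \<and>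
        (\<Sum>z\<in>{z \<in> V. f z = w}. zorder (\<lambda>u. f u - w) z) = int d)"

definition polynomial_like :: "(complex \<Rightarrow> complex) \<Rightarrow> complex set \<Rightarrow> complex set \<Rightarrow> bool" where
  "polynomial_like f V W \<longleftrightarrow>
     bsc_smooth_domain V \<and> bsc_smooth_domain W \<and> closure V \<subseteq> W \<and>
     f holomorphic_on V \<and> proper_map_on f V W \<and>
     (\<exists>d\<ge>2. map_degree_on f V W d)"

definition transcendental_entire :: "(complex \<Rightarrow> complex) \<Rightarrow> bool" where
  "transcendental_entire f \<longleftrightarrow> f holomorphic_on UNIV \<and> \<not> (\<exists>p. \<forall>z. f z = poly p z)"

definition strongly_polynomial_like :: "(complex \<Rightarrow> complex) \<Rightarrow> bool" where
  "strongly_polynomial_like f \<longleftrightarrow>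
     (\<exists>V W :: nat \<Rightarrow> complex set.
        (\<forall>n. bsc_smooth_domain (V n) \<and> bsc_smooth_domain (W n)) \<and>
        (\<forall>n. V n \<subseteq> V (Suc n) \<and> W n \<subseteq> W (Suc n)) \<and>
        (\<Union>n. V n) = UNIV \<and> (\<Union>n. W n) = UNIV \<and>
        (\<forall>n. polynomial_like f (V n) (W n)))"

definition surrounds :: "complex set \<Rightarrow> complex set \<Rightarrow> bool" where
  "surrounds S A \<longleftrightarrow> (\<exists>C \<in> components (- S). bounded C \<and> A \<subseteq> C)"

end

theory Submission
  imports Defs
begin

text \<open>
  Proper maps send boundary onto boundary, so \<open>f\<close> maps the boundary of \<open>V\<^sub>n\<close> onto that of
  \<open>W\<^sub>n\<close>, which surrounds the closure of \<open>V\<^sub>n\<close>; a subsequence of \<open>(V\<^sub>n)\<close> is the required exhaustion.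

  Conversely, let \<open>\<Omega>\<close> be the component of the complement of \<open>f(\<partial>D)\<close> containing the closure of \<open>D\<close>.
  As \<open>f(\<partial>D)\<close> is connected, \<open>\<Omega>\<close> is simply connected. Take a Riemann map \<open>\<phi>\<close> of \<open>\<Omega>\<close> onto the disc and
  let \<open>W = {\<bar>\<phi>\<bar> < r}\<close>, where \<open>r\<close> is close to \<open>1\<close> and \<open>\<partial>W\<close> avoids the finitely many critical values
  coming from the closure of \<open>D\<close>. A component \<open>V\<close> of the preimage of \<open>W\<close> that meets \<open>D\<close> stays inside \<open>D\<close>, it is
  simply connected because the complement of \<open>W\<close> is connected, and its boundary is connected and covers
  the circle of radius \<open>r\<close> under \<open>\<phi> \<circ> f\<close>. Lifting the exponential parametrisation of the circle
  through this covering yields a closed analytic curve that parametrises \<open>\<partial>V\<close>. Since \<open>f\<close> is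
  not injective, the degree is at least two for large domains.
\<close>

subsection \<open>Finite coverings and components\<close>

text \<open>An infinite fibre would accumulate at some point of the compact set \<open>C\<close>,
  and near that point \<open>p\<close> would be injective on infinitely many points sharing one
  value.\<close>

lemma finite_fiber_of_locally_inj:
  fixes p :: "'a::t1_space \<Rightarrow> 'b"
  assumes "compact C" and "\<And>z. z \<in> C \<Longrightarrow> \<exists>N. open N \<and> z \<in> N \<and> inj_on p (N \<inter> C)"
  shows "finite {z \<in> C. p z = w}"
proof (rule ccontr)
  let ?F = "{z \<in> C. p z = w}"
  assume "infinite ?F"
  then obtain x where x: "x \<in> C" "x islimpt ?F"
    using Heine_Borel_imp_Bolzano_Weierstrass[OF \<open>compact C\<close>, of ?F] by auto
  then obtain N where N: "open N" "x \<in> N" "inj_on p (N \<inter> C)"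
    using assms(2) by blast
  have "infinite (N \<inter> ?F)"
    using x N by (auto simp: islimpt_eq_acc_point)
  moreover have "inj_on p (N \<inter> ?F)"
    using N(3) by (rule inj_on_subset) auto
  moreover have "finite (p ` (N \<inter> ?F))"
    by (rule finite_subset[of _ "{w}"]) auto
  ultimately show False
    using finite_imageD by blast
qed

text \<open>Compactness makes the fibre over \<open>w\<close> finite, so its points have disjoint
  neighbourhoods on which \<open>p\<close> is a homeomorphism. The rest of \<open>C\<close> has a
  compact image missing \<open>w\<close>, and the common part of the image neighbourhoods minus this
  image is evenly covered.\<close>

lemma covering_space_compact_local_homeomorphism:
  fixes p :: "'a::metric_space \<Rightarrow> 'b::t2_space"
  assumes "compact C" and contp: "continuous_on C p" and im: "p ` C = S"
    and loc: "\<And>z. z \<in> C \<Longrightarrow> \<exists>T q. openin (top_of_set C) T \<and> z \<in> T \<and>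
                 openin (top_of_set S) (p ` T) \<and> homeomorphism T (p ` T) p q"
  shows "covering_space C p S"
proof -
  obtain T q where T: "\<And>z. z \<in> C \<Longrightarrow> openin (top_of_set C) (T z)" "\<And>z. z \<in> C \<Longrightarrow> z \<in> T z"
    "\<And>z. z \<in> C \<Longrightarrow> openin (top_of_set S) (p ` T z)"
    "\<And>z. z \<in> C \<Longrightarrow> homeomorphism (T z) (p ` T z) p (q z)"
    using loc by metis
  have "\<exists>N. w \<in> N \<and> openin (top_of_set S) N \<and>
          (\<exists>v. \<Union>v = C \<inter> p -` N \<and> (\<forall>u \<in> v. openin (top_of_set C) u) \<and>
               pairwise disjnt v \<and> (\<forall>u \<in> v. \<exists>q. homeomorphism u N p q))"
    if "w \<in> S" for w
  proof -
    define F where "F = {z \<in> C. p z = w}"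
    have FC: "F \<subseteq> C" and Fne: "F \<noteq> {}"
      using that im by (auto simp: F_def)
    have inj: "inj_on p (T z)" if "z \<in> C" for z
      using homeomorphism_apply1[OF T(4)[OF that]] by (rule inj_on_inverseI)
    have "finite F"
      unfolding F_def
    proof (rule finite_fiber_of_locally_inj[OF \<open>compact C\<close>])
      fix z assume z: "z \<in> C"
      then show "\<exists>N. open N \<and> z \<in> N \<and> inj_on p (N \<inter> C)"
        using T(1,2)[OF z] inj[OF z] by (auto simp: openin_open Int_commute)
    qed
    then obtain e where e: "e > 0" "\<And>x y. x \<in> F \<Longrightarrow> y \<in> F \<Longrightarrow> dist x y < e \<Longrightarrow> x = y"
    proof -
      \<comment> \<open>The entry \<open>1\<close> keeps \<open>D\<close> nonempty when the fibre is
        a single point.\<close>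
      define D where "D = insert 1 ((\<lambda>(x,y). dist x y) ` {(x,y) \<in> F \<times> F. x \<noteq> y})"
      have "finite {(x,y) \<in> F \<times> F. x \<noteq> y}"
        using \<open>finite F\<close> by (intro finite_subset[OF _ finite_cartesian_product[of F F]]) auto
      then have D: "finite D" "D \<noteq> {}"
        by (auto simp: D_def)
      have "Min D > 0"
        using D by (subst Min_gr_iff) (auto simp: D_def)
      moreover have "Min D \<le> dist x y" if "x \<in> F" "y \<in> F" "x \<noteq> y" for x y
        using D that by (intro Min_le) (auto simp: D_def)
      ultimately show ?thesis
        using that by (meson not_less)
    qed
    define U where "U z = T z \<inter> ball z (e/2)" for z
    have U: "openin (top_of_set C) (U z)" "z \<in> U z" "U z \<subseteq> T z" "U z \<subseteq> C" if "z \<in> F" for z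
    proof -
      have z: "z \<in> C"
        using FC that by blast
      show "openin (top_of_set C) (U z)"
        unfolding U_def by (rule openin_Int_open[OF T(1)[OF z] open_ball])
      then show "U z \<subseteq> C"
        by (rule openin_imp_subset)
      show "z \<in> U z" "U z \<subseteq> T z"
        using T(2)[OF z] e(1) by (auto simp: U_def)
    qed
    have pU: "openin (top_of_set S) (p ` U z)" if "z \<in> F" for z
    proof -
      have z: "z \<in> C"
        using FC that by blast
      have "openin (top_of_set (T z)) (U z)"
        unfolding U_def by (simp add: openin_open_Int)
      then have "openin (top_of_set (p ` T z)) (p ` U z)"
        using T(4)[OF z] homeomorphism_imp_open_map by blast
      then show ?thesis
        using T(3)[OF z] openin_trans by blast
    qed
    define K where "K = p ` (C - (\<Union>z\<in>F. U z))"
    have "openin (top_of_set C) (\<Union>z\<in>F. U z)"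
      using U by blast
    then have "closedin (top_of_set C) (C - (\<Union>z\<in>F. U z))"
      using closedin_diff[OF closedin_topspace, of "top_of_set C"] by simp
    then have "compact (C - (\<Union>z\<in>F. U z))"
      using \<open>compact C\<close> closedin_compact by blast
    then have "compact K"
      unfolding K_def by (intro compact_continuous_image continuous_on_subset[OF contp]) auto
    then have "closed K"
      by (rule compact_imp_closed)
    \<comment> \<open>Subtracting \<open>K\<close> forces every preimage of a point of
      \<open>N\<close> into one of the sheets \<open>U z\<close>.\<close>
    define N where "N = (\<Inter>z\<in>F. p ` U z) - K"
    have "openin (top_of_set S) (\<Inter>z\<in>F. p ` U z)"
      using \<open>finite F\<close> Fne pU by (intro openin_INT2) auto
    then have N: "openin (top_of_set S) N"
      unfolding N_def Diff_eq using \<open>closed K\<close> by (intro openin_Int_open) auto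
    have NU: "N \<subseteq> p ` U z" if "z \<in> F" for z
      using that by (auto simp: N_def)
    have "w \<notin> K"
      using U(2) by (fastforce simp: K_def F_def)
    moreover have "w \<in> p ` U z" if "z \<in> F" for z
      using that U(2)[OF that] by (force simp: F_def)
    ultimately have "w \<in> N"
      by (auto simp: N_def)
    define v where "v = (\<lambda>z. U z \<inter> p -` N) ` F"
    have "\<Union>v = C \<inter> p -` N"
      using U(4) by (fastforce simp: v_def N_def K_def)
    moreover have "openin (top_of_set C) u" if "u \<in> v" for u
    proof -
      from that obtain z where z: "z \<in> F" "u = U z \<inter> p -` N"
        by (auto simp: v_def)
      have "openin (top_of_set C) (C \<inter> p -` N)"
        using continuous_on_open[of C p] contp im N by auto
      moreover have "u = U z \<inter> (C \<inter> p -` N)"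
        using z U(4) by blast
      ultimately show ?thesis
        using U(1) z by (simp add: openin_Int)
    qed
    moreover have "pairwise disjnt v"
    proof (clarsimp simp: pairwise_def v_def disjnt_def)
      fix x y assume "x \<in> F" "y \<in> F" and ne: "U x \<inter> p -` N \<noteq> U y \<inter> p -` N"
      then have "x \<noteq> y" by auto
      then have "e \<le> dist x y"
        using e(2) \<open>x \<in> F\<close> \<open>y \<in> F\<close> by force
      then have "ball x (e/2) \<inter> ball y (e/2) = {}"
        by (intro disjoint_ballI) auto
      then show "U x \<inter> p -` N \<inter> (U y \<inter> p -` N) = {}"
        by (auto simp: U_def)
    qed
    moreover have "\<exists>q. homeomorphism u N p q" if "u \<in> v" for u
    proof -
      from that obtain z where z: "z \<in> F" "u = U z \<inter> p -` N"
        by (auto simp: v_def)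
      have "p ` u = N"
        using NU[OF z(1)] z by auto
      then have "homeomorphism u N p (q z)"
        using homeomorphism_of_subsets[OF T(4)[of z], of u N] z U(3) FC by blast
      then show ?thesis by blast
    qed
    ultimately show ?thesis
      using \<open>w \<in> N\<close> N by (intro exI[of _ N] conjI exI[of _ v]) auto
  qed
  then show ?thesis
    unfolding covering_space_def using contp im by blast
qed

lemma covering_space_finite_fiber:
  fixes p :: "'a::metric_space \<Rightarrow> 'b::t2_space"
  assumes cov: "covering_space C p S" and "compact C"
  shows "finite {z \<in> C. p z = w}"
proof (rule finite_fiber_of_locally_inj[OF \<open>compact C\<close>])
  fix z assume z: "z \<in> C"
  then have "p z \<in> S"
    using covering_space_imp_surjective[OF cov] by blast
  then obtain T v where T: "p z \<in> T" "\<Union>v = C \<inter> p -` T" "\<forall>u\<in>v. openin (top_of_set C) u"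
      "\<forall>u\<in>v. \<exists>q. homeomorphism u T p q"
    using cov unfolding covering_space_def by metis
  then obtain u where u: "u \<in> v" "z \<in> u"
    using z by blast
  then obtain q where q: "homeomorphism u T p q"
    using T(4) by blast
  have "inj_on p u"
    using homeomorphism_apply1[OF q] by (rule inj_on_inverseI)
  then show "\<exists>N. open N \<and> z \<in> N \<and> inj_on p (N \<inter> C)"
    using T(3) u by (auto simp: openin_open Int_commute)
qed

text \<open>The component of a point of \<open>X\<close> is an open neighbourhood of it; if the
  point is on the frontier of \<open>V\<close>, this neighbourhood meets \<open>V\<close> and so
  equals \<open>V\<close>, but \<open>V\<close> is open and misses its own frontier.\<close>

lemma frontier_component_open:
  fixes X :: "'a::real_normed_vector set"
  assumes "open X" and V: "V \<in> components X"
  shows "frontier V \<inter> X = {}"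
proof -
  have "open V"
    using open_components[OF assms] .
  have False if "z \<in> X" and z: "z \<in> frontier V" for z
  proof -
    let ?C = "connected_component_set X z"
    have zV: "z \<in> closure V" "z \<notin> V"
      using z \<open>open V\<close> by (auto simp: frontier_def interior_open)
    have "open ?C" "z \<in> ?C"
      using \<open>open X\<close> \<open>z \<in> X\<close> by (auto simp: open_connected_component connected_component_refl)
    then have "?C \<inter> V \<noteq> {}"
      using zV(1) by (meson closure_iff_nhds_not_empty order_refl disjoint_iff)
    then have "?C = V"
      using components_nonoverlap[OF componentsI[OF \<open>z \<in> X\<close>] V] by simp
    then show False
      using zV(2) \<open>z \<in> ?C\<close> by blast
  qed
  then show ?thesis
    by blast
qed

lemma compact_subset_incseq_open:
  fixes U :: "nat \<Rightarrow> 'a::topological_space set"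
  assumes "compact K" and "\<And>n. open (U n)" and "incseq U" and "(\<Union>n. U n) = UNIV"
  shows "\<exists>m. K \<subseteq> U m"
proof -
  obtain N where N: "finite N" "K \<subseteq> (\<Union>n\<in>N. U n)"
    using compactE_image[OF \<open>compact K\<close>, of UNIV U] assms(2,4) by auto
  have "U n \<subseteq> U (Max N)" if "n \<in> N" for n
    using N(1) that \<open>incseq U\<close> by (simp add: incseqD)
  then show ?thesis
    using N(2) by blast
qed

text \<open>Thins out an exhaustion so that each member is related to the next one as required; the
  bound \<open>m\<close> allows a late start.\<close>

lemma subsequence_choice:
  assumes "\<And>n::nat. \<exists>k. \<forall>j\<ge>k. Q n j"
  shows "\<exists>s. strict_mono s \<and> m \<le> s 0 \<and> (\<forall>n. Q (s n) (s (Suc n)))"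
proof -
  have "\<exists>s. \<forall>n. m \<le> s n \<and> s n < s (Suc n) \<and> Q (s n) (s (Suc n))"
  proof (rule dependent_nat_choice)
    fix x n :: nat assume "m \<le> x"
    obtain k where "\<forall>j\<ge>k. Q x j"
      using assms by blast
    then show "\<exists>y. m \<le> y \<and> x < y \<and> Q x y"
      using \<open>m \<le> x\<close> by (intro exI[of _ "max k (Suc x)"]) auto
  qed auto
  then show ?thesis
    using strict_mono_Suc_iff by blast
qed

subsection \<open>Analytic curves\<close>

text \<open>Real-analyticity in the form of local holomorphic extension. It passes to the derivative
  at once, which yields all the iterated derivatives demanded by
  \<open>smooth_boundary\<close>.\<close>

definition analytic_curve :: "(real \<Rightarrow> complex) \<Rightarrow> bool" where
  "analytic_curve \<gamma> \<longleftrightarrow>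
     (\<forall>t. \<exists>F. \<exists>e>0. F holomorphic_on ball (of_real t) e \<and> (\<forall>s. \<bar>s - t\<bar> < e \<longrightarrow> \<gamma> s = F (of_real s)))"

lemma analytic_curve_vector_derivative:
  assumes "F holomorphic_on ball (of_real t) e" and "\<And>s. \<bar>s - t\<bar> < e \<Longrightarrow> \<gamma> s = F (of_real s)"
    and "\<bar>s - t\<bar> < e"
  shows "(\<gamma> has_vector_derivative deriv F (of_real s)) (at s)"
proof -
  have "complex_of_real s \<in> ball (of_real t) e"
    using assms(3) by (simp add: dist_norm abs_minus_commute flip: of_real_diff)
  then have "(F has_field_derivative deriv F (of_real s)) (at (of_real s))"
    using assms(1) holomorphic_derivI open_ball by blast
  then have "((\<lambda>x. F (of_real x)) has_vector_derivative deriv F (of_real s)) (at s)"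
    by (rule has_vector_derivative_real_field)
  moreover have "eventually (\<lambda>x. \<bar>x - t\<bar> < e) (nhds s)"
    using assms(3) by (intro eventually_nhds_in_open[of "{x. \<bar>x - t\<bar> < e}", simplified] open_Collect_less continuous_intros)
  ultimately show ?thesis
    using assms(2,3) by (subst has_vector_derivative_cong_ev[where g = "\<lambda>x. F (of_real x)"]) (auto elim!: eventually_mono)
qed

lemma analytic_curve_differentiable:
  assumes "analytic_curve \<gamma>"
  shows "\<gamma> differentiable (at t)"
proof -
  obtain F e where "e > 0" "F holomorphic_on ball (of_real t) e" "\<And>s. \<bar>s - t\<bar> < e \<Longrightarrow> \<gamma> s = F (of_real s)"
    using assms unfolding analytic_curve_def by metis
  then have "(\<gamma> has_vector_derivative deriv F (of_real t)) (at t)"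
    by (intro analytic_curve_vector_derivative) auto
  then show ?thesis
    by (rule differentiableI_vector)
qed

lemma analytic_curve_vderiv:
  assumes "analytic_curve \<gamma>"
  shows "analytic_curve (\<lambda>t. vector_derivative \<gamma> (at t))"
  unfolding analytic_curve_def
proof
  fix t
  obtain F e where Fe: "e > 0" "F holomorphic_on ball (of_real t) e" "\<And>s. \<bar>s - t\<bar> < e \<Longrightarrow> \<gamma> s = F (of_real s)"
    using assms unfolding analytic_curve_def by metis
  have "vector_derivative \<gamma> (at s) = deriv F (of_real s)" if "\<bar>s - t\<bar> < e" for s
    using analytic_curve_vector_derivative[OF Fe(2,3) that] by (rule vector_derivative_at)
  then show "\<exists>F. \<exists>e>0. F holomorphic_on ball (of_real t) e \<and>
      (\<forall>s. \<bar>s - t\<bar> < e \<longrightarrow> vector_derivative \<gamma> (at s) = F (of_real s))"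
    using Fe holomorphic_deriv by blast
qed

lemma analytic_curve_iter_vderiv: "analytic_curve \<gamma> \<Longrightarrow> analytic_curve (iter_vderiv n \<gamma>)"
  by (induction n) (auto simp: iter_vderiv_def analytic_curve_vderiv)

text \<open>Since \<open>deriv h\<close> does not vanish along the curve, \<open>h\<close> has a
  local holomorphic inverse \<open>g\<close>, and continuity of \<open>\<eta>\<close> keeps nearby
  values where \<open>g\<close> inverts \<open>h\<close>. So \<open>\<eta>\<close> is locally
  \<open>g \<circ> G\<close> on the real axis.\<close>

lemma analytic_curve_lift:
  assumes holh: "h holomorphic_on Q" and "open Q" and \<eta>Q: "\<And>t. \<eta> t \<in> Q"
    and dh: "\<And>t. deriv h (\<eta> t) \<noteq> 0" and cont: "continuous_on UNIV \<eta>"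
    and holG: "G holomorphic_on UNIV" and lift: "\<And>t::real. h (\<eta> t) = G (of_real t)"
  shows "analytic_curve \<eta>"
  unfolding analytic_curve_def
proof
  fix t
  obtain \<rho> where \<rho>: "\<rho> > 0" "ball (\<eta> t) \<rho> \<subseteq> Q" "inj_on h (ball (\<eta> t) \<rho>)"
    using has_complex_derivative_locally_injective[OF holh \<eta>Q \<open>open Q\<close> dh] by metis
  let ?B = "ball (\<eta> t) \<rho>"
  have holB: "h holomorphic_on ?B"
    using holh \<rho>(2) holomorphic_on_subset by blast
  obtain g where g: "g holomorphic_on h ` ?B" "\<And>z. z \<in> ?B \<Longrightarrow> g (h z) = z"
    using holomorphic_has_inverse[OF holB open_ball \<rho>(3)] by metis
  have "open (h ` ?B)"
    using open_mapping_thm3[OF holB open_ball \<rho>(3)] .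
  moreover have contG: "continuous_on UNIV G"
    using holG holomorphic_on_imp_continuous_on by blast
  ultimately have "open (G -` (h ` ?B))"
    using open_vimage[of "h ` ?B" G] by blast
  moreover have "of_real t \<in> G -` (h ` ?B)"
    using lift[of t] \<rho>(1) by (metis centre_in_ball imageI vimageI)
  ultimately obtain e1 where e1: "e1 > 0" "ball (of_real t) e1 \<subseteq> G -` (h ` ?B)"
    using openE by blast
  obtain e2 where e2: "e2 > 0" "\<And>s. dist s t < e2 \<Longrightarrow> dist (\<eta> s) (\<eta> t) < \<rho>"
    using cont \<rho>(1) unfolding continuous_on_iff by (metis UNIV_I)
  let ?e = "min e1 e2"
  have "(g \<circ> G) holomorphic_on ball (of_real t) ?e"
    using e1(2) by (intro holomorphic_on_compose_gen[OF holomorphic_on_subset[OF holG] g(1)]) auto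
  moreover have "\<eta> s = (g \<circ> G) (of_real s)" if "\<bar>s - t\<bar> < ?e" for s
  proof -
    have "\<eta> s \<in> ?B"
      using e2(2)[of s] that by (simp add: dist_commute dist_real_def)
    then show ?thesis
      using g(2) lift by (metis comp_apply)
  qed
  ultimately show "\<exists>F. \<exists>e>0. F holomorphic_on ball (of_real t) e \<and> (\<forall>s. \<bar>s - t\<bar> < e \<longrightarrow> \<eta> s = F (of_real s))"
    using e1(1) e2(1) by (intro exI[of _ "g \<circ> G"] exI[of _ ?e]) auto
qed

text \<open>By the chain rule a zero derivative of \<open>\<eta>\<close> would give a zero
  derivative of \<open>h \<circ> \<eta>\<close>, which is \<open>G\<close> on the real axis.\<close>

lemma vector_derivative_lift_nonzero:
  assumes holh: "h holomorphic_on Q" and "open Q" and \<eta>Q: "\<eta> t \<in> Q"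
    and diff: "\<eta> differentiable (at t)"
    and holG: "G holomorphic_on UNIV" and lift: "\<And>t::real. h (\<eta> t) = G (of_real t)"
    and dG: "deriv G (of_real t) \<noteq> 0"
  shows "vector_derivative \<eta> (at t) \<noteq> 0"
proof
  assume "vector_derivative \<eta> (at t) = 0"
  then have "(\<eta> has_vector_derivative 0) (at t)"
    using diff vector_derivative_works by metis
  moreover have "(h has_field_derivative deriv h (\<eta> t)) (at (\<eta> t))"
    using holh \<open>open Q\<close> \<eta>Q holomorphic_derivI by blast
  ultimately have "((h \<circ> \<eta>) has_vector_derivative 0 * deriv h (\<eta> t)) (at t)"
    by (rule field_vector_diff_chain_at)
  moreover have "h \<circ> \<eta> = (\<lambda>t. G (of_real t))"
    using lift by auto
  moreover have "((\<lambda>t. G (of_real t)) has_vector_derivative deriv G (of_real t)) (at t)"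
    using holG by (intro has_vector_derivative_real_field holomorphic_derivI[of _ UNIV]) auto
  ultimately show False
    using dG vector_derivative_unique_at by (metis mult_zero_left)
qed

subsection \<open>Boundaries of level components\<close>

text \<open>Continuity gives \<open>\<le> r\<close> on the closure of \<open>V\<close>, while the
  frontier avoids the open sublevel set.\<close>

lemma frontier_component_norm_eq:
  assumes holh: "h holomorphic_on Q" and "open Q"
    and V: "V \<in> components {z \<in> Q. norm (h z) < r}" and "closure V \<subseteq> Q" and z: "z \<in> frontier V"
  shows "norm (h z) = r"
proof -
  let ?X = "{z \<in> Q. norm (h z) < r}"
  have conth: "continuous_on Q h"
    using holh by (rule holomorphic_on_imp_continuous_on)
  have "?X = Q \<inter> h -` ball 0 r"
    by (auto simp: dist_norm)
  then have "open ?X"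
    using continuous_open_preimage[OF conth \<open>open Q\<close> open_ball] by metis
  then have "z \<notin> ?X"
    using frontier_component_open[OF _ V] z by blast
  moreover have "z \<in> Q"
    using z \<open>closure V \<subseteq> Q\<close> by (auto simp: frontier_def)
  ultimately have "\<not> norm (h z) < r"
    by simp
  moreover have "norm (h z) \<le> r"
  proof -
    have "h ` closure V \<subseteq> cball 0 r"
    proof (rule image_closure_subset)
      show "continuous_on (closure V) h"
        using conth \<open>closure V \<subseteq> Q\<close> by (rule continuous_on_subset)
    qed (use in_components_subset[OF V] in auto)
    then show ?thesis
      using z by (auto simp: frontier_def)
  qed
  ultimately show ?thesis
    by simp
qed

text \<open>Near \<open>z\<close> the map \<open>h\<close> is biholomorphic onto a neighbourhood of
  a small disc about \<open>h z\<close>. The part of that disc inside \<open>ball 0 r\<close> is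
  connected, so its preimage lies in the single component \<open>V\<close>; hence the frontier near
  \<open>z\<close> is the whole level set and corresponds to an arc of the circle.\<close>

lemma local_inverse_at_frontier:
  assumes holh: "h holomorphic_on Q" and "open Q"
    and V: "V \<in> components {z \<in> Q. norm (h z) < r}" and clV: "closure V \<subseteq> Q" and z: "z \<in> frontier V"
    and dh: "deriv h z \<noteq> 0"
  obtains N g where "open N" "z \<in> N" "homeomorphism (N \<inter> frontier V) (h ` (N \<inter> frontier V)) h g"
    "openin (top_of_set (sphere 0 r)) (h ` (N \<inter> frontier V))"
proof -
  let ?X = "{z \<in> Q. norm (h z) < r}"
  have hz: "norm (h z) = r"
    using frontier_component_norm_eq[OF holh \<open>open Q\<close> V clV z] .
  have "z \<in> closure V"
    using z by (auto simp: frontier_def)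
  then have "z \<in> Q"
    using clV by blast
  then obtain \<rho> where \<rho>: "\<rho> > 0" "ball z \<rho> \<subseteq> Q" "inj_on h (ball z \<rho>)"
    using has_complex_derivative_locally_injective[OF holh _ \<open>open Q\<close> dh] by metis
  let ?B = "ball z \<rho>"
  have holB: "h holomorphic_on ?B"
    using holh \<rho>(2) holomorphic_on_subset by blast
  have contB: "continuous_on ?B h"
    using holB by (rule holomorphic_on_imp_continuous_on)
  obtain g where g: "g holomorphic_on h ` ?B" "\<And>z. z \<in> ?B \<Longrightarrow> g (h z) = z"
    using holomorphic_has_inverse[OF holB open_ball \<rho>(3)] by metis
  have contg: "continuous_on (h ` ?B) g"
    using g(1) by (rule holomorphic_on_imp_continuous_on)
  have "open (h ` ?B)"
    using open_mapping_thm3[OF holB open_ball \<rho>(3)] .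
  moreover have "h z \<in> h ` ?B"
    using \<rho>(1) by simp
  ultimately obtain \<epsilon> where \<epsilon>: "\<epsilon> > 0" "ball (h z) \<epsilon> \<subseteq> h ` ?B"
    using openE by blast
  define N where "N = ?B \<inter> h -` ball (h z) \<epsilon>"
  have "open N"
    unfolding N_def using contB by (rule continuous_open_preimage) auto
  have "z \<in> N"
    using \<rho>(1) \<epsilon>(1) by (simp add: N_def)
  have gN: "g w \<in> N" "h (g w) = w" if "w \<in> ball (h z) \<epsilon>" for w
    using that \<epsilon>(2) g(2) by (auto simp: N_def)
  \<comment> \<open>The intersection of two discs is convex, so \<open>A\<close> is connected; as it
    meets \<open>V\<close>, it is absorbed by that component.\<close>
  define A where "A = g ` (ball (h z) \<epsilon> \<inter> ball 0 r)"
  have "A \<subseteq> ?X"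
    using gN \<rho>(2) by (auto simp: A_def N_def)
  have "connected A"
    unfolding A_def using \<epsilon>(2)
    by (intro connected_continuous_image continuous_on_subset[OF contg] convex_connected convex_Int convex_ball) auto
  have "A \<inter> V \<noteq> {}"
  proof -
    obtain y where y: "y \<in> V" "y \<in> N"
      using \<open>z \<in> closure V\<close> \<open>open N\<close> \<open>z \<in> N\<close> by (meson closure_iff_nhds_not_empty order_refl disjoint_iff)
    then have "norm (h y) < r"
      using in_components_subset[OF V] by blast
    then have "y \<in> A"
      using y g(2) unfolding A_def N_def by (auto intro!: image_eqI[of _ _ "h y"])
    then show ?thesis
      using y by blast
  qed
  then have "A \<subseteq> V"
    using components_maximal[OF V \<open>connected A\<close> \<open>A \<subseteq> ?X\<close>] by blast
  have eq: "N \<inter> frontier V = {y \<in> N. norm (h y) = r}"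
  proof (intro equalityI subsetI; clarsimp)
    fix y assume "y \<in> frontier V"
    then show "norm (h y) = r"
      using frontier_component_norm_eq[OF holh \<open>open Q\<close> V clV] by blast
  next
    fix y assume y: "y \<in> N" "r = norm (h y)"
    have hy: "h y \<in> ball (h z) \<epsilon>" "g (h y) = y"
      using y(1) g(2) by (auto simp: N_def)
    \<comment> \<open>Only for positive \<open>r\<close> is the closure of \<open>ball 0 r\<close>
      the closed disc; a ball of radius zero is empty.\<close>
    have "r > 0"
      using \<open>A \<inter> V \<noteq> {}\<close> by (auto simp: A_def dest: le_less_trans[OF norm_ge_zero])
    have "h y \<in> closure (ball (h z) \<epsilon> \<inter> ball 0 r)"
    proof -
      have "h y \<in> closure (ball 0 r)"
        using y(2) \<open>r > 0\<close> by simp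
      then show ?thesis
        using hy(1) open_Int_closure_subset[OF open_ball, of "h z" \<epsilon> "ball 0 r"] by blast
    qed
    moreover have "isCont g (h y)"
      using contg hy(1) \<epsilon>(2) continuous_on_subset continuous_on_eq_continuous_at open_ball by metis
    ultimately have "g (h y) \<in> closure A"
      unfolding A_def closure_sequential
      by (metis (no_types, lifting) imageI isCont_tendsto_compose)
    then have "y \<in> closure V"
      using hy(2) closure_mono[OF \<open>A \<subseteq> V\<close>] by auto
    moreover have "y \<notin> V"
      using y(2) in_components_subset[OF V] by auto
    ultimately show "y \<in> frontier V"
      using interior_subset by (auto simp: frontier_def)
  qed
  have im: "h ` (N \<inter> frontier V) = sphere 0 r \<inter> ball (h z) \<epsilon>"
  proof (intro equalityI subsetI)
    fix w assume "w \<in> sphere 0 r \<inter> ball (h z) \<epsilon>"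
    then show "w \<in> h ` (N \<inter> frontier V)"
      unfolding eq using gN by (intro image_eqI[of _ _ "g w"]) auto
  qed (use frontier_component_norm_eq[OF holh \<open>open Q\<close> V clV] in \<open>auto simp: N_def\<close>)
  have "homeomorphism (N \<inter> frontier V) (h ` (N \<inter> frontier V)) h g"
  proof (rule homeomorphismI)
    show "continuous_on (N \<inter> frontier V) h"
      using contB by (rule continuous_on_subset) (auto simp: N_def)
    show "continuous_on (h ` (N \<inter> frontier V)) g"
      using contg by (rule continuous_on_subset) (auto simp: N_def)
  qed (use g(2) in \<open>auto simp: N_def\<close>)
  moreover have "openin (top_of_set (sphere 0 r)) (h ` (N \<inter> frontier V))"
    unfolding im by (simp add: openin_open_Int)
  ultimately show ?thesis
    using that \<open>open N\<close> \<open>z \<in> N\<close> by blast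
qed

text \<open>Local inverses make the image of the frontier open in the circle and compactness makes
  it closed. It is nonempty because \<open>V\<close> is bounded, so it is the whole connected
  circle.\<close>

lemma covering_space_frontier:
  assumes holh: "h holomorphic_on Q" and "open Q"
    and V: "V \<in> components {z \<in> Q. norm (h z) < r}" and bV: "bounded V" and clV: "closure V \<subseteq> Q"
    and dh: "\<And>z. z \<in> frontier V \<Longrightarrow> deriv h z \<noteq> 0"
  shows "covering_space (frontier V) h (sphere 0 r)"
proof -
  have cpt: "compact (frontier V)"
    using bV by (simp add: compact_frontier_bounded)
  have cont: "continuous_on (frontier V) h"
    using holomorphic_on_imp_continuous_on[OF holh]
    by (rule continuous_on_subset) (use clV in \<open>auto simp: frontier_def\<close>)
  have sub: "h ` frontier V \<subseteq> sphere 0 r"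
    using frontier_component_norm_eq[OF holh \<open>open Q\<close> V clV] by auto
  have "\<exists>N g. open N \<and> z \<in> N \<and>
      homeomorphism (N \<inter> frontier V) (h ` (N \<inter> frontier V)) h g \<and>
      openin (top_of_set (sphere 0 r)) (h ` (N \<inter> frontier V))" if "z \<in> frontier V" for z
    by (rule local_inverse_at_frontier[OF holh \<open>open Q\<close> V clV that dh[OF that]]) blast
  then obtain N g where N: "\<And>z. z \<in> frontier V \<Longrightarrow> open (N z) \<and> z \<in> N z \<and>
      homeomorphism (N z \<inter> frontier V) (h ` (N z \<inter> frontier V)) h (g z) \<and>
      openin (top_of_set (sphere 0 r)) (h ` (N z \<inter> frontier V))"
    by metis
  have "h ` frontier V = (\<Union>z\<in>frontier V. h ` (N z \<inter> frontier V))"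
    using N by blast
  moreover have "openin (top_of_set (sphere 0 r)) (\<Union>z\<in>frontier V. h ` (N z \<inter> frontier V))"
    using N by (intro openin_Union) auto
  ultimately have "openin (top_of_set (sphere 0 r)) (h ` frontier V)"
    by simp
  moreover have "closedin (top_of_set (sphere 0 r)) (h ` frontier V)"
    using sub compact_imp_closed[OF compact_continuous_image[OF cont cpt]]
    by (rule closed_subset)
  moreover have "V \<noteq> {}" "V \<noteq> UNIV"
    using V bV in_components_nonempty not_bounded_UNIV by auto
  then have "h ` frontier V \<noteq> {}"
    by (simp add: frontier_eq_empty)
  moreover have "connected (sphere (0::complex) r)"
    by (rule connected_sphere) simp
  ultimately have im: "h ` frontier V = sphere 0 r"
    using connected_clopen by metis
  show ?thesis
  proof (rule covering_space_compact_local_homeomorphism[OF cpt cont im])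
    fix z assume z: "z \<in> frontier V"
    have "openin (top_of_set (frontier V)) (N z \<inter> frontier V)"
      using N[OF z] by (metis inf_commute openin_open_Int)
    then show "\<exists>T q. openin (top_of_set (frontier V)) T \<and> z \<in> T \<and>
        openin (top_of_set (sphere 0 r)) (h ` T) \<and> homeomorphism T (h ` T) h q"
      using N[OF z] z by (intro exI[of _ "N z \<inter> frontier V"] exI[of _ "g z"]) auto
  qed
qed

text \<open>The frontier is a compact connected covering of a circle, hence a single loop: one lift
  of the exponential map \<open>G\<close> runs through all of it, and rescaling by the least period
  of the lift gives an injective parametrisation.\<close>

lemma smooth_boundary_level_component:
  assumes holh: "h holomorphic_on Q" and "open Q" and "r > 0"
    and V: "V \<in> components {z \<in> Q. norm (h z) < r}" and bV: "bounded V" and clV: "closure V \<subseteq> Q"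
    and dh: "\<And>z. z \<in> frontier V \<Longrightarrow> deriv h z \<noteq> 0" and conn: "connected (frontier V)"
  shows "smooth_boundary V"
proof -

  \<comment> \<open>The exponential parametrisation of the circle and its lifts\<close>
  define G where "G w = of_real r * exp (2 * of_real pi * \<i> * w)" for w
  have holG: "G holomorphic_on A" for A
    unfolding G_def by (intro holomorphic_intros)
  have "(G has_field_derivative 2 * of_real pi * \<i> * G w) (at w)" for w
    unfolding G_def by (auto intro!: derivative_eq_intros)
  then have "deriv G w = 2 * of_real pi * \<i> * G w" for w
    by (rule DERIV_imp_deriv)
  then have dG: "deriv G w \<noteq> 0" for w
    using \<open>r > 0\<close> by (simp add: G_def)
  have G_eq: "G (of_real s) = G (of_real t) \<longleftrightarrow> (\<exists>m::int. s = t + of_int m)" for s t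
  proof -
    have "G (of_real s) = G (of_real t) \<longleftrightarrow>
        (\<exists>m::int. 2 * of_real pi * \<i> * complex_of_real s = 2 * of_real pi * \<i> * of_real t + of_int (2 * m) * of_real pi * \<i>)"
      using \<open>r > 0\<close> by (simp add: G_def exp_eq)
    also have "\<dots> \<longleftrightarrow> (\<exists>m::int. 2 * of_real pi * \<i> * complex_of_real s = 2 * of_real pi * \<i> * of_real (t + of_int m))"
      by (simp add: algebra_simps)
    also have "\<dots> \<longleftrightarrow> (\<exists>m::int. s = t + of_int m)"
      by (simp only: mult_cancel_left of_real_eq_iff) simp
    finally show ?thesis .
  qed
  have contG: "continuous_on UNIV (\<lambda>t::real. G (of_real t))"
    unfolding G_def by (intro continuous_intros)
  have Gim: "G (of_real t) \<in> sphere 0 r" for t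
    using \<open>r > 0\<close> by (simp add: G_def norm_mult)
  have cov: "covering_space (frontier V) h (sphere 0 r)"
    using covering_space_frontier[OF holh \<open>open Q\<close> V bV clV dh] .
  have cpt: "compact (frontier V)"
    using bV by (simp add: compact_frontier_bounded)
  define lift where "lift \<delta> \<longleftrightarrow> continuous_on UNIV \<delta> \<and> range \<delta> \<subseteq> frontier V \<and>
      (\<forall>t. h (\<delta> t) = G (of_real t))" for \<delta> :: "real \<Rightarrow> complex"
  have ex_lift: "\<exists>\<delta> t. lift \<delta> \<and> \<delta> t = y" if y: "y \<in> frontier V" for y
  proof -
    have "norm (h y) = r"
      using covering_space_imp_surjective[OF cov] y by auto
    then have "h y = of_real r * exp (\<i> * of_real (Arg (h y)))"
      using \<open>r > 0\<close> Arg_eq[of "h y"] by auto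
    \<comment> \<open>The parameter at which \<open>G\<close> passes through \<open>h y\<close>; the
      lift is normalised to take the value \<open>y\<close> there.\<close>
    then have hy: "G (of_real (Arg (h y) / (2 * pi))) = h y"
      by (simp add: G_def)
    obtain \<delta> where "continuous_on UNIV \<delta>" "\<delta> \<in> UNIV \<rightarrow> frontier V" "\<delta> (Arg (h y) / (2 * pi)) = y"
        "\<And>t. t \<in> UNIV \<Longrightarrow> h (\<delta> t) = G (of_real t)"
      by (rule covering_space_lift_strong[OF cov y UNIV_I convex_imp_simply_connected
            convex_imp_locally_path_connected contG _ hy]) (use Gim in auto)
    then show ?thesis
      unfolding lift_def by blast
  qed
  have lift_unique: "\<delta> = \<delta>'" if "lift \<delta>" "lift \<delta>'" "\<delta> s = \<delta>' s" for \<delta> \<delta>' s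
  proof
    fix t
    show "\<delta> t = \<delta>' t"
      by (rule covering_space_lift_unique[OF cov, of \<delta> s \<delta>' UNIV "\<lambda>t. G (of_real t)"])
        (use that Gim contG in \<open>auto simp: lift_def\<close>)
  qed

  \<comment> \<open>Translates and periods of lifts\<close>
  have lift_shift: "lift (\<lambda>t. \<delta> (t + of_int m))" if "lift \<delta>" for \<delta> m
  proof -
    have "continuous_on UNIV (\<lambda>t. \<delta> (t + of_int m))"
      using that unfolding lift_def
      by (auto intro!: continuous_on_compose2[of UNIV \<delta>] continuous_intros)
    moreover have "G (of_real (t + of_int m)) = G (of_real t)" for t
      using G_eq by blast
    ultimately show ?thesis
      using that unfolding lift_def by auto
  qed
  \<comment> \<open>One coincidence between a lift and its integer translate makes the translation a
    period, by uniqueness of lifts.\<close>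
  have lift_period: "\<delta> (x + of_int m) = \<delta> x" if "lift \<delta>" "\<delta> (t + of_int m) = \<delta> t" for \<delta> m t x
    using lift_unique[OF lift_shift[OF that(1)] that] by metis
  have fin: "finite {z \<in> frontier V. h z = G 0}"
    using covering_space_finite_fiber[OF cov cpt] .
  \<comment> \<open>Pigeonhole: the values of a lift at the natural numbers all lie in the finite
    fibre over \<open>G 0\<close>, so two of them agree.\<close>
  have ex_period: "\<exists>k::nat. k > 0 \<and> (\<forall>t. \<delta> (t + of_nat k) = \<delta> t)" if \<delta>: "lift \<delta>" for \<delta>
  proof -
    have "\<delta> (of_nat n) \<in> {z \<in> frontier V. h z = G 0}" for n
    proof -
      have "G (of_real (of_nat n)) = G (of_real 0)"
        unfolding G_eq by (rule exI[of _ "int n"]) simp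
      moreover have "h (\<delta> (of_nat n)) = G (of_real (of_nat n))" "\<delta> (of_nat n) \<in> frontier V"
        using \<delta> by (auto simp only: lift_def)
      ultimately show ?thesis
        by simp
    qed
    then have "finite (range (\<lambda>n::nat. \<delta> (of_nat n)))"
      by (intro finite_subset[OF _ fin]) auto
    then have "\<not> inj (\<lambda>n::nat. \<delta> (of_nat n))"
      using range_inj_infinite by blast
    then obtain m n :: nat where mn: "m < n" "\<delta> (of_nat m) = \<delta> (of_nat n)"
      by (metis injI linorder_neqE_nat)
    have "of_nat m + of_int (int (n - m)) = (of_nat n :: real)"
      using mn(1) by simp
    then have "\<delta> (of_nat m + of_int (int (n - m))) = \<delta> (of_nat m)"
      using mn(2) by simp
    then have "\<delta> (x + of_int (int (n - m))) = \<delta> x" for x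
      by (rule lift_period[OF \<delta>])
    then show ?thesis
      using mn(1) by (intro exI[of _ "n - m"]) auto
  qed
  have range_period: "range \<delta> = \<delta> ` {0..of_nat k}" if "k > 0" "\<And>t. \<delta> (t + of_nat k) = \<delta> t" for \<delta> :: "real \<Rightarrow> complex" and k :: nat
  proof (intro equalityI subsetI; clarsimp)
    fix t :: real
    have per: "\<delta> (x + of_nat n * of_nat k) = \<delta> x" for x and n :: nat
    proof (induction n)
      case (Suc n)
      have "x + of_nat (Suc n) * of_nat k = (x + of_nat n * of_nat k) + of_nat k"
        by (simp add: algebra_simps)
      then show ?case
        using that(2) Suc by metis
    qed simp
    \<comment> \<open>Reduction of \<open>t\<close> modulo \<open>k\<close>. Since
      \<open>per\<close> iterates the period only forwards, the sign of \<open>m\<close> decides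
      whether it starts from \<open>s\<close> or from \<open>t\<close>.\<close>
    define m where "m = \<lfloor>t / of_nat k\<rfloor>"
    define s where "s = t - of_int m * of_nat k"
    have "of_int m \<le> t / of_nat k" "t / of_nat k < of_int m + 1"
      unfolding m_def by linarith+
    then have "s \<in> {0..of_nat k}"
      using that(1) by (simp add: s_def field_simps)
    moreover have "\<delta> t = \<delta> s"
    proof (cases "m \<ge> 0")
      case True
      then show ?thesis
        using per[of s "nat m"] by (simp add: s_def)
    next
      case False
      then show ?thesis
        using per[of t "nat (- m)"] by (simp add: s_def)
    qed
    ultimately show "\<delta> t \<in> \<delta> ` {0..real k}"
      by blast
  qed
  have cpt_range: "compact (range \<delta>)" if \<delta>: "lift \<delta>" for \<delta>
  proof -
    obtain k :: nat where "k > 0" "\<And>t. \<delta> (t + of_nat k) = \<delta> t"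
      using ex_period[OF \<delta>] by blast
    then have "range \<delta> = \<delta> ` {0..of_nat k}"
      by (rule range_period)
    moreover have "compact (\<delta> ` {0..of_nat k})"
      using \<delta> unfolding lift_def by (intro compact_continuous_image) (auto intro: continuous_on_subset)
    ultimately show ?thesis by simp
  qed
  \<comment> \<open>A lift is determined by its value at \<open>0\<close>, which lies in a finite
    fibre.\<close>
  have fin_lift: "finite {\<delta>. lift \<delta>}"
  proof (rule inj_on_finite[OF _ _ fin])
    show "inj_on (\<lambda>\<delta>. \<delta> 0) {\<delta>. lift \<delta>}"
      using lift_unique by (intro inj_onI) auto
    show "(\<lambda>\<delta>. \<delta> 0) ` {\<delta>. lift \<delta>} \<subseteq> {z \<in> frontier V. h z = G 0}"
      by (auto simp: lift_def)
  qed

  \<comment> \<open>One lift covers the whole frontier\<close>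
  have "V \<noteq> {}" "V \<noteq> UNIV"
    using V bV in_components_nonempty not_bounded_UNIV by auto
  then obtain y where "y \<in> frontier V"
    by (metis ex_in_conv frontier_eq_empty)
  then obtain \<delta> where \<delta>: "lift \<delta>"
    using ex_lift by blast
  \<comment> \<open>The ranges of the finitely many lifts are compact and pairwise equal or disjoint, so
    connectedness of the frontier leaves room for only one of them.\<close>
  have range_\<delta>: "range \<delta> = frontier V"
  proof (rule ccontr)
    assume ne: "range \<delta> \<noteq> frontier V"
    define B where "B = (\<Union>\<delta>'\<in>{\<delta>'. lift \<delta>' \<and> range \<delta>' \<inter> range \<delta> = {}}. range \<delta>')"
    have "finite {\<delta>'. lift \<delta>' \<and> range \<delta>' \<inter> range \<delta> = {}}"
      using fin_lift by (rule rev_finite_subset) auto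
    then have "closed B"
      unfolding B_def using cpt_range compact_imp_closed by (intro closed_UN) auto
    moreover have "closed (range \<delta>)"
      using cpt_range[OF \<delta>] compact_imp_closed by blast
    moreover have "frontier V \<subseteq> range \<delta> \<union> B"
    proof
      fix y assume "y \<in> frontier V"
      then obtain \<delta>' t where \<delta>': "lift \<delta>'" "\<delta>' t = y"
        using ex_lift by blast
      show "y \<in> range \<delta> \<union> B"
      proof (cases "range \<delta>' \<inter> range \<delta> = {}")
        case True
        then show ?thesis
          using \<delta>' by (auto simp: B_def)
      next
        case False
        then obtain s u where su: "\<delta>' s = \<delta> u"
          by blast
        then have "G (of_real s) = G (of_real u)"
          using \<delta> \<delta>'(1) unfolding lift_def by metis
        then obtain m :: int where m: "s = u + of_int m"
          using G_eq by blast
        have "(\<lambda>t. \<delta>' (t + of_int m)) = \<delta>"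
          using lift_unique[OF lift_shift[OF \<delta>'(1)] \<delta>, of u] su m by simp
        then have "\<delta> (t - of_int m) = y"
          using \<delta>'(2) by (metis diff_add_cancel)
        then show ?thesis
          by blast
      qed
    qed
    moreover have sub: "range \<delta> \<subseteq> frontier V" "B \<subseteq> frontier V"
      using \<delta> by (auto simp: lift_def B_def)
    moreover have "B \<noteq> {}"
      using calculation(3) sub ne by auto
    moreover have "range \<delta> \<inter> B = {}"
      by (auto simp: B_def)
    ultimately show False
      using connected_closedD[OF conn, of "range \<delta>" B] inf_absorb1[OF sub(1)] inf_absorb1[OF sub(2)] by auto
  qed

  \<comment> \<open>The least period and the parametrising curve\<close>
  let ?P = "\<lambda>k::nat. k > 0 \<and> (\<forall>t. \<delta> (t + of_nat k) = \<delta> t)"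
  define k where "k = (LEAST k. ?P k)"
  have k: "k > 0" "\<And>t. \<delta> (t + of_nat k) = \<delta> t"
    using LeastI_ex[OF ex_period[OF \<delta>]] unfolding k_def by auto
  have k_least: "k \<le> n" if "n > 0" "\<And>t. \<delta> (t + of_nat n) = \<delta> t" for n
    unfolding k_def using that by (intro Least_le) auto
  define \<eta> where "\<eta> t = \<delta> (of_nat k * t)" for t
  have cont: "continuous_on UNIV \<eta>"
    using \<delta> unfolding lift_def \<eta>_def
    by (auto intro!: continuous_on_compose2[of UNIV \<delta>] continuous_intros)
  have \<eta>fr: "\<eta> t \<in> frontier V" for t
    using range_\<delta> unfolding \<eta>_def by blast
  then have \<eta>Q: "\<eta> t \<in> Q" for t
    using clV by (auto simp: frontier_def)
  define H where "H w = G (of_nat k * w)" for w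
  have holH: "H holomorphic_on UNIV"
    unfolding H_def G_def by (intro holomorphic_intros)
  have "(H has_field_derivative deriv G (of_nat k * w) * of_nat k) (at w)" for w
  proof -
    have 1: "(G has_field_derivative deriv G (of_nat k * w)) (at (of_nat k * w))"
      using holomorphic_derivI[OF holG[of UNIV] open_UNIV] by blast
    have 2: "((*) (of_nat k) has_field_derivative of_nat k) (at w)"
      by (auto intro!: derivative_eq_intros)
    show ?thesis
      unfolding H_def using DERIV_chain2[OF 1 2] .
  qed
  then have "deriv H w = deriv G (of_nat k * w) * of_nat k" for w
    by (rule DERIV_imp_deriv)
  then have dH: "deriv H w \<noteq> 0" for w
    using dG k(1) by simp
  have lift: "h (\<eta> t) = H (of_real t)" for t
    using \<delta> unfolding lift_def \<eta>_def H_def by simp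
  have ana: "analytic_curve \<eta>"
    by (rule analytic_curve_lift[OF holh \<open>open Q\<close> \<eta>Q dh[OF \<eta>fr] cont holH lift])
  have "vector_derivative \<eta> (at t) \<noteq> 0" for t
    by (rule vector_derivative_lift_nonzero[OF holh \<open>open Q\<close> \<eta>Q analytic_curve_differentiable[OF ana]
          holH lift dH])
  moreover have "\<eta> (t + 1) = \<eta> t" for t
    using k(2)[of "of_nat k * t"] by (simp add: \<eta>_def algebra_simps)
  moreover have "iter_vderiv n \<eta> differentiable (at t)" for n t
    using analytic_curve_differentiable[OF analytic_curve_iter_vderiv[OF ana]] .
  moreover have "inj_on \<eta> {0..<1}"
  proof (rule linorder_inj_onI)
    fix s t :: real assume "s < t" and st: "s \<in> {0..<1}" "t \<in> {0..<1}"
    show "\<eta> s \<noteq> \<eta> t"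
    proof
      assume eq: "\<eta> s = \<eta> t"
      then have "G (of_real (of_nat k * t)) = G (of_real (of_nat k * s))"
        using \<delta> unfolding \<eta>_def lift_def by metis
      then obtain m :: int where m: "of_nat k * t = of_nat k * s + of_int m"
        using G_eq by blast
      \<comment> \<open>The integer \<open>m\<close> is a period of \<open>\<delta>\<close> strictly
        between \<open>0\<close> and \<open>k\<close>, against the minimality of
        \<open>k\<close>.\<close>
      have "of_int m = of_nat k * (t - s)"
        using m by (simp add: algebra_simps)
      moreover have "of_nat k * (t - s) > 0" "of_nat k * (t - s) < of_nat k * 1"
        using k(1) \<open>s < t\<close> st by (auto intro!: mult_strict_left_mono)
      ultimately have "m > 0" "m < int k"
        by linarith+
      have "\<delta> (x + of_int m) = \<delta> x" for x
        using lift_period[OF \<delta>, of "of_nat k * s" m] eq m by (simp add: \<eta>_def)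
      then have "k \<le> nat m"
        using \<open>m > 0\<close> by (intro k_least) auto
      then show False
        using \<open>m < int k\<close> \<open>m > 0\<close> by linarith
    qed
  qed auto
  moreover have "frontier V = \<eta> ` {0..1}"
  proof -
    have "(*) (of_nat k) ` {0..1::real} = {0..of_nat k}"
      using k(1) by (simp add: image_mult_atLeastAtMost)
    then have "\<eta> ` {0..1} = \<delta> ` {0..of_nat k}"
      unfolding \<eta>_def by (metis image_image)
    then show ?thesis
      using range_\<delta> range_period[of k \<delta>, OF k(1)] k(2) by simp
  qed
  ultimately show ?thesis
    unfolding smooth_boundary_def by blast
qed

subsection \<open>Preimages of simply connected domains\<close>

lemma simply_connected_component_preimage:
  assumes holf: "f holomorphic_on UNIV" and nonconst: "\<not> f constant_on UNIV"
    and W: "open W" "bounded W" "connected (- W)" and V: "V \<in> components (f -` W)"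
  shows "simply_connected V"
proof -
  have contf: "continuous_on A f" for A
    using holf holomorphic_on_imp_continuous_on continuous_on_subset by blast
  have "open (f -` W)"
    using W(1) contf by (simp add: open_vimage)
  then have "open V"
    using V open_components by blast
  have "winding_number \<gamma> z = 0"
    if \<gamma>: "path \<gamma>" "path_image \<gamma> \<subseteq> V" "pathfinish \<gamma> = pathstart \<gamma>" and z: "z \<notin> V" for \<gamma> z
  proof (rule ccontr)
    assume wn: "winding_number \<gamma> z \<noteq> 0"
    let ?K = "path_image \<gamma>"
    have K: "compact ?K" "connected ?K" "?K \<noteq> {}"
      using \<gamma>(1) by (auto simp: compact_path_image connected_path_image)
    have zK: "z \<in> - ?K"
      using z \<gamma>(2) by auto
    let ?B = "connected_component_set (- ?K) z"
    have B: "?B \<in> components (- ?K)"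
      using zK by (rule componentsI)
    have "z \<notin> outside ?K"
      using wn winding_number_zero_in_outside[OF \<gamma>(1,3)] by blast
    then have "bounded ?B"
      using zK by (auto simp: outside_def)
    have "open ?B"
      using K(1) by (intro open_connected_component) (simp add: compact_imp_closed open_Compl)
    have frB: "frontier ?B \<subseteq> ?K"
      using frontier_of_components_closed_complement[OF compact_imp_closed[OF K(1)] B] .
    have "z \<in> ?B"
      using zK by simp
    \<comment> \<open>By the open mapping theorem the part of \<open>f ` ?B\<close> outside \<open>W\<close> is clopen in \<open>- W\<close>, and it is bounded.\<close>
    have "f ` ?B \<subseteq> W"
    proof (rule ccontr)
      assume "\<not> f ` ?B \<subseteq> W"
      then have ne: "- W \<inter> f ` ?B \<noteq> {}"
        by blast
      have "open (f ` ?B)"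
        using open_mapping_thm[OF holf open_UNIV connected_UNIV \<open>open ?B\<close> _ nonconst] by auto
      then have op: "openin (top_of_set (- W)) (- W \<inter> f ` ?B)"
        by (rule openin_open_Int)
      have "f ` closure ?B = f ` ?B \<union> f ` frontier ?B"
        by (metis closure_Un_frontier image_Un)
      moreover have "f ` frontier ?B \<subseteq> W"
        using frB \<gamma>(2) in_components_subset[OF V] by blast
      ultimately have "- W \<inter> f ` ?B = - W \<inter> f ` closure ?B"
        by blast
      moreover have "compact (f ` closure ?B)"
        using compact_closure[THEN iffD2, OF \<open>bounded ?B\<close>] by (rule compact_continuous_image[OF contf])
      ultimately have cl: "closedin (top_of_set (- W)) (- W \<inter> f ` ?B)"
        by (metis closedin_closed_Int compact_imp_closed)
      have "- W \<inter> f ` ?B = - W"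
        using W(3) op cl ne connected_clopen by blast
      then have "- W \<subseteq> f ` closure ?B"
        using closure_subset by blast
      then have "bounded (- W)"
        using \<open>compact (f ` closure ?B)\<close> bounded_subset compact_imp_bounded by blast
      then show False
        using W(2) by (metis bounded_Un Compl_partition not_bounded_UNIV)
    qed
    have "frontier ?B \<noteq> {}"
      using \<open>z \<in> ?B\<close> \<open>bounded ?B\<close> by (metis empty_iff frontier_eq_empty not_bounded_UNIV)
    then have "closure ?B \<inter> ?K \<noteq> {}"
      using frB by (auto simp: frontier_def)
    then have "connected (closure ?B \<union> ?K)"
      using K(2) by (intro connected_Un connected_imp_connected_closure) (auto simp: Int_commute)
    moreover have "closure ?B \<union> ?K \<subseteq> f -` W"
      using frB \<open>f ` ?B \<subseteq> W\<close> \<gamma>(2) in_components_subset[OF V] closure_Un_frontier[of ?B] by blast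
    moreover have "V \<inter> (closure ?B \<union> ?K) \<noteq> {}"
      using \<gamma>(2) K(3) by blast
    ultimately have "closure ?B \<union> ?K \<subseteq> V"
      using components_maximal[OF V] by blast
    then show False
      using \<open>z \<in> ?B\<close> closure_subset z by blast
  qed
  then show ?thesis
    using simply_connected_eq_winding_number_zero[OF \<open>open V\<close>] in_components_connected[OF V] by blast
qed

text \<open>The frontier of \<open>V\<close> avoids the preimage of \<open>W\<close>, so the points
  of \<open>V\<close> mapped into \<open>K\<close> are the same as those of the compact closure of
  \<open>V\<close>.\<close>

lemma proper_map_on_component_preimage:
  assumes contf: "continuous_on UNIV f" and "open W" and V: "V \<in> components (f -` W)" and "bounded V"
  shows "proper_map_on f V W"
  unfolding proper_map_on_def
proof (intro conjI allI impI)
  have VW: "V \<subseteq> f -` W"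
    using V by (rule in_components_subset)
  then show "f ` V \<subseteq> W"
    by blast
  fix K assume K: "K \<subseteq> W \<and> compact K"
  have "open (f -` W)"
    using \<open>open W\<close> contf by (simp add: open_vimage)
  then have "frontier V \<inter> f -` K = {}"
    using frontier_component_open[OF _ V] K by blast
  then have "{z \<in> V. f z \<in> K} = closure V \<inter> f -` K"
    using closure_Un_frontier[of V] by blast
  moreover have "closed (f -` K)"
    using K contf by (simp add: closed_vimage compact_imp_closed)
  ultimately show "compact {z \<in> V. f z \<in> K}"
    using \<open>bounded V\<close> by (simp add: compact_Int_closed compact_closure)
qed

text \<open>If \<open>f z\<close> were in \<open>W\<close>, a closed disc about it would have a
  compact preimage in \<open>V\<close>. This preimage is closed and \<open>z\<close> is a limit of
  its points, so \<open>z\<close> would lie in \<open>V\<close>.\<close>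

lemma proper_map_on_frontier:
  assumes contf: "continuous_on UNIV f" and "open V" "open W" and proper: "proper_map_on f V W"
    and z: "z \<in> frontier V"
  shows "f z \<in> frontier W"
proof -
  have zV: "z \<in> closure V" "z \<notin> V"
    using z \<open>open V\<close> by (auto simp: frontier_def interior_open)
  have fV: "f ` V \<subseteq> W"
    using proper by (simp add: proper_map_on_def)
  have "f ` closure V \<subseteq> closure W"
    using contf fV closure_subset by (intro image_closure_subset) (auto intro: continuous_on_subset)
  then have "f z \<in> closure W"
    using zV(1) by blast
  moreover have "f z \<notin> W"
  proof
    assume "f z \<in> W"
    then obtain e where e: "e > 0" "cball (f z) e \<subseteq> W"
      using \<open>open W\<close> open_contains_cball by blast
    define A where "A = {y \<in> V. f y \<in> cball (f z) e}"
    have "compact A"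
      using proper e(2) compact_cball unfolding proper_map_on_def A_def by blast
    then have "closed A"
      by (rule compact_imp_closed)
    have op: "open (f -` ball (f z) e)"
      using contf by (simp add: open_vimage)
    have "z \<in> closure (f -` ball (f z) e \<inter> V)"
      using open_Int_closure_subset[OF op, of V] zV(1) e(1) by auto
    also have "closure (f -` ball (f z) e \<inter> V) \<subseteq> A"
      using \<open>closed A\<close> by (intro closure_minimal) (auto simp: A_def)
    finally show False
      using zV(2) by (simp add: A_def)
  qed
  ultimately show ?thesis
    using \<open>open W\<close> by (simp add: frontier_def interior_open)
qed

subsection \<open>Mapping degree\<close>

text \<open>Turns the periodic parametrisation into a simple closed path suitable for winding
  numbers. By the Jordan curve theorem the inside is connected; it contains the bounded set
  \<open>V\<close> and cannot leave it without crossing the frontier.\<close>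

lemma smooth_boundary_imp_simple_path:
  assumes "open V" "connected V" "bounded V" "V \<noteq> {}" "smooth_boundary V"
  obtains \<gamma> where "valid_path \<gamma>" "simple_path \<gamma>" "pathfinish \<gamma> = pathstart \<gamma>"
    "path_image \<gamma> = frontier V" "inside (path_image \<gamma>) = V"
proof -
  obtain \<gamma> :: "real \<Rightarrow> complex" where \<gamma>: "\<And>t. \<gamma> (t + 1) = \<gamma> t" "\<And>n t. iter_vderiv n \<gamma> differentiable (at t)"
      "inj_on \<gamma> {0..<1}" "frontier V = \<gamma> ` {0..1}"
    using assms(5) unfolding smooth_boundary_def by blast
  have "\<gamma> C1_differentiable_on {0..1}"
    unfolding C1_differentiable_on_eq
  proof
    show "\<forall>t\<in>{0..1}. \<gamma> differentiable (at t)"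
      using \<gamma>(2)[of 0] by (simp add: iter_vderiv_def)
    have "(\<lambda>t. vector_derivative \<gamma> (at t)) differentiable (at t)" for t
      using \<gamma>(2)[of 1] by (simp add: iter_vderiv_def)
    then show "continuous_on {0..1} (\<lambda>t. vector_derivative \<gamma> (at t))"
      by (intro continuous_at_imp_continuous_on ballI differentiable_imp_continuous_within)
  qed
  then have vp: "valid_path \<gamma>"
    by (simp add: valid_path_def C1_differentiable_imp_piecewise)
  have \<gamma>01: "\<gamma> 1 = \<gamma> 0"
    using \<gamma>(1)[of 0] by simp
  have "loop_free \<gamma>"
    unfolding loop_free_def
  proof (intro ballI impI)
    fix x y :: real assume xy: "x \<in> {0..1}" "y \<in> {0..1}" "\<gamma> x = \<gamma> y"
    \<comment> \<open>Moves the end parameter \<open>1\<close> to \<open>0\<close>, so that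
      injectivity on the half-open interval applies.\<close>
    let ?m = "\<lambda>x::real. if x = 1 then 0 else x"
    have "\<gamma> (?m x) = \<gamma> (?m y)"
      using xy \<gamma>01 by auto
    moreover have "?m x \<in> {0..<1}" "?m y \<in> {0..<1}"
      using xy by auto
    ultimately have "?m x = ?m y"
      by (rule inj_onD[OF \<gamma>(3)])
    then show "x = y \<or> x = 0 \<and> y = 1 \<or> x = 1 \<and> y = 0"
      by (auto split: if_splits)
  qed
  then have sp: "simple_path \<gamma>"
    using vp by (simp add: simple_path_def valid_path_imp_path)
  have lp: "pathfinish \<gamma> = pathstart \<gamma>"
    by (simp add: pathfinish_def pathstart_def \<gamma>01)
  have im: "path_image \<gamma> = frontier V"
    using \<gamma>(4) by (simp add: path_image_def)
  note J = Jordan_inside_outside[OF sp lp, unfolded im]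
  have disj: "V \<inter> frontier V = {}"
    using \<open>open V\<close> by (auto simp: frontier_def interior_open)
  have sub: "C \<subseteq> V" if "connected C" "C \<inter> V \<noteq> {}" "C \<inter> frontier V = {}" for C
    using connected_Int_frontier[OF that(1,2)] that(3) by blast
  have "inside (frontier V) = V"
  proof
    show VI: "V \<subseteq> inside (frontier V)"
    proof
      fix x assume x: "x \<in> V"
      have "x \<in> connected_component_set (- frontier V) x"
        using x disj by auto
      then have "connected_component_set (- frontier V) x \<subseteq> V"
        using x connected_component_subset[of "- frontier V" x]
        by (intro sub connected_connected_component) blast+
      then have "bounded (connected_component_set (- frontier V) x)"
        using \<open>bounded V\<close> bounded_subset by blast
      then show "x \<in> inside (frontier V)"
        using x disj by (auto simp: inside_def)
    qed
    show "inside (frontier V) \<subseteq> V"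
      using J VI \<open>V \<noteq> {}\<close> by (intro sub) (auto simp: inside_no_overlap)
  qed
  then show ?thesis
    using that[OF vp sp lp im] im by simp
qed

lemma entire_finite_fiber:
  assumes "f holomorphic_on UNIV" "\<not> f constant_on UNIV" "compact K"
  shows "finite {z \<in> K. f z = w}"
proof -
  have "\<not> (\<lambda>z. f z - w) constant_on UNIV"
    using assms(2) unfolding constant_on_def by (metis diff_add_cancel)
  then have "finite {z \<in> K. f z - w = 0}"
    using assms by (intro holomorphic_compact_finite_zeros[of _ UNIV]) (auto intro!: holomorphic_intros)
  then show ?thesis
    by simp
qed

text \<open>The solutions of \<open>f u = w\<close> are isolated, so \<open>f - w\<close> does not
  vanish identically near \<open>z\<close> and its order there is that of a genuine zero.\<close>

lemma entire_zorder_pos: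
  assumes holf: "f holomorphic_on UNIV" and nonconst: "\<not> f constant_on UNIV" and "f z = w"
  shows "zorder (\<lambda>u. f u - w) z > 0"
proof -
  have "\<not> z islimpt {u \<in> cball z 1. f u = w}"
    using entire_finite_fiber[OF holf nonconst compact_cball] by (rule islimpt_finite)
  then have "eventually (\<lambda>u. u \<notin> {u \<in> cball z 1. f u = w}) (at z)"
    by (simp add: islimpt_iff_eventually)
  moreover have "eventually (\<lambda>u. u \<in> ball z 1) (at z)"
    by (intro eventually_at_in_open') auto
  ultimately have "eventually (\<lambda>u. f u - w \<noteq> 0) (at z)"
    by eventually_elim auto
  then have "frequently (\<lambda>u. f u - w \<noteq> 0) (at z)"
    by (intro eventually_frequently) auto
  then show ?thesis
    using zorder_pos_iff[OF holomorphic_on_diff[OF holf holomorphic_on_const] open_UNIV UNIV_I, of w z] \<open>f z = w\<close>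
    by simp
qed

text \<open>By the argument principle the number of preimages of \<open>w\<close>, with
  multiplicity, is up to a fixed factor the winding number of \<open>f \<circ> \<gamma>\<close>
  about \<open>w\<close>. This curve avoids the connected set \<open>W\<close>, so the number is
  constant there.\<close>

lemma proper_map_degree:
  assumes holf: "f holomorphic_on UNIV" and nonconst: "\<not> f constant_on UNIV"
    and V: "open V" "connected V" "bounded V" "V \<noteq> {}" "smooth_boundary V"
    and W: "open W" "connected W" and proper: "proper_map_on f V W"
  shows "\<exists>d. map_degree_on f V W d"
proof -
  obtain \<gamma> where vp: "valid_path \<gamma>" and sp: "simple_path \<gamma>" and lp: "pathfinish \<gamma> = pathstart \<gamma>"
    and im: "path_image \<gamma> = frontier V" and ins: "inside (path_image \<gamma>) = V"
    using smooth_boundary_imp_simple_path[OF V] by blast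
  have contf: "continuous_on A f" for A
    using holf holomorphic_on_imp_continuous_on continuous_on_subset by blast
  \<comment> \<open>The value \<open>c\<close> is \<open>1\<close> or \<open>-1\<close> according to
    the orientation of \<open>\<gamma>\<close>; being nonzero, it can be cancelled later.\<close>
  obtain c :: complex where c: "c \<noteq> 0" "\<And>z. z \<in> V \<Longrightarrow> winding_number \<gamma> z = c"
    using simple_closed_path_winding_number_inside[OF sp, unfolded ins]
    by (metis neg_equal_0_iff_equal one_neq_zero)
  have fr: "f z \<notin> W" if "z \<in> frontier V" for z
    using proper_map_on_frontier[OF contf V(1) W(1) proper that] W(1) by (auto simp: frontier_def interior_open)
  obtain R where R: "closure V \<subseteq> ball 0 R"
    using bounded_subset_ballD[of "closure V" 0] V(3) by auto
  define Z where "Z w = {z \<in> V. f z = w}" for w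
  have finZ: "finite (Z w)" for w
    using closure_subset[of V]
    by (intro finite_subset[OF _ entire_finite_fiber[OF holf nonconst compact_closure[THEN iffD2, OF V(3)], of w]])
      (auto simp: Z_def)
  have vpf: "valid_path (f \<circ> \<gamma>)"
    using vp holf by (rule valid_path_compose_holomorphic) auto
  have eq: "winding_number (f \<circ> \<gamma>) w = c * of_int (\<Sum>z\<in>Z w. zorder (\<lambda>u. f u - w) z)" if w: "w \<in> W" for w
  proof -
    have finB: "finite {z \<in> ball 0 R. f z = w}"
      by (rule finite_subset[OF _ entire_finite_fiber[OF holf nonconst compact_cball[of 0 R], of w]]) auto
    have "w \<notin> path_image (f \<circ> \<gamma>)"
      using fr w im by (auto simp: path_image_compose)
    then have "winding_number (f \<circ> \<gamma>) w = 1 / (2 * pi * \<i>) * contour_integral (f \<circ> \<gamma>) (\<lambda>x. 1 / (x - w))"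
      using vpf by (rule winding_number_valid_path[rotated])
    also have "contour_integral (f \<circ> \<gamma>) (\<lambda>x. 1 / (x - w)) = contour_integral \<gamma> (\<lambda>x. deriv f x * (1 / (f x - w)))"
      using vp holf by (intro contour_integral_comp_analyticW[of f UNIV]) (auto simp: analytic_on_open)
    also have "\<dots> = contour_integral \<gamma> (\<lambda>x. deriv (\<lambda>u. f u - w) x * 1 / (f x - w))"
    proof -
      have "deriv (\<lambda>u. f u - w) x = deriv f x" for x
        using holomorphic_derivI[OF holf open_UNIV, of x] by (intro DERIV_imp_deriv) (auto intro!: derivative_eq_intros)
      then show ?thesis
        by simp
    qed
    \<comment> \<open>The argument principle without poles and with constant weight
      \<open>1\<close>. It counts the zeros in the whole disc; those outside \<open>V\<close> drop
      out below because \<open>\<gamma>\<close> does not wind around them.\<close>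
    also have "\<dots> = 2 * pi * \<i> * (\<Sum>p\<in>{z \<in> ball 0 R. f z - w = 0 \<or> z \<in> {}}. winding_number \<gamma> p * 1 * zorder (\<lambda>u. f u - w) p)"
    proof (rule argument_principle)
      show "path_image \<gamma> \<subseteq> ball 0 R - {z \<in> ball 0 R. f z - w = 0 \<or> z \<in> {}}"
        using im R fr w by (auto simp: frontier_def)
      then show "\<forall>z. z \<notin> ball 0 R \<longrightarrow> winding_number \<gamma> z = 0"
        using winding_number_zero_outside[OF valid_path_imp_path[OF vp] convex_ball lp] by blast
      show "(\<lambda>u. f u - w) holomorphic_on ball 0 R - {}"
        using holf by (intro holomorphic_intros) (auto intro: holomorphic_on_subset)
    qed (use vp lp finB in auto)
    also have "{z \<in> ball 0 R. f z - w = 0 \<or> z \<in> {}} = {z \<in> ball 0 R. f z = w}"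
      by auto
    also have "(\<Sum>p\<in>{z \<in> ball 0 R. f z = w}. winding_number \<gamma> p * 1 * zorder (\<lambda>u. f u - w) p)
        = (\<Sum>p\<in>Z w. winding_number \<gamma> p * 1 * zorder (\<lambda>u. f u - w) p)"
    proof (rule sum.mono_neutral_right[OF finB])
      show "Z w \<subseteq> {z \<in> ball 0 R. f z = w}"
        using R closure_subset[of V] by (auto simp: Z_def)
      have "winding_number \<gamma> z = 0" if "z \<notin> V" "f z = w" for z
      proof -
        have "z \<notin> frontier V"
          using fr w that(2) by blast
        then have "z \<in> outside (path_image \<gamma>)"
          using that(1) inside_Un_outside[of "path_image \<gamma>"] ins im by blast
        then show ?thesis
          by (rule winding_number_zero_in_outside[OF valid_path_imp_path[OF vp] lp])
      qed
      then show "\<forall>p\<in>{z \<in> ball 0 R. f z = w} - Z w. winding_number \<gamma> p * 1 * zorder (\<lambda>u. f u - w) p = 0"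
        by (auto simp: Z_def)
    qed
    also have "\<dots> = c * of_int (\<Sum>z\<in>Z w. zorder (\<lambda>u. f u - w) z)"
      unfolding of_int_sum sum_distrib_left using c(2) by (intro sum.cong) (auto simp: Z_def)
    finally show ?thesis
      by (simp add: o_def)
  qed
  have "winding_number (f \<circ> \<gamma>) constant_on W"
  proof (rule winding_number_constant)
    show "path (f \<circ> \<gamma>)" "connected W"
      using vpf W by (auto simp: valid_path_imp_path)
    show "pathfinish (f \<circ> \<gamma>) = pathstart (f \<circ> \<gamma>)"
      using lp by (simp add: pathfinish_compose pathstart_compose)
    show "W \<inter> path_image (f \<circ> \<gamma>) = {}"
      using fr im by (auto simp: path_image_compose)
  qed
  then obtain n where n: "\<And>w. w \<in> W \<Longrightarrow> winding_number (f \<circ> \<gamma>) w = n"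
    unfolding constant_on_def by blast
  obtain z0 where "z0 \<in> V"
    using V(4) by blast
  then have w0: "f z0 \<in> W"
    using proper by (auto simp: proper_map_on_def)
  define d where "d = (\<Sum>z\<in>Z (f z0). zorder (\<lambda>u. f u - f z0) z)"
  have "d \<ge> 0"
    unfolding d_def
    by (intro sum_nonneg less_imp_le entire_zorder_pos[OF holf nonconst]) (simp add: Z_def)
  moreover have "(\<Sum>z\<in>Z w. zorder (\<lambda>u. f u - w) z) = d" if "w \<in> W" for w
  proof -
    have "c * of_int (\<Sum>z\<in>Z w. zorder (\<lambda>u. f u - w) z) = c * of_int d"
      unfolding d_def using eq[OF that] eq[OF w0] n[OF that] n[OF w0] by simp
    then show ?thesis
      using c(1) by (simp only: mult_cancel_left of_int_eq_iff) simp
  qed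
  ultimately show ?thesis
    unfolding map_degree_on_def using finZ by (intro exI[of _ "nat d"]) (simp add: Z_def)
qed

text \<open>Two distinct preimages of one value each contribute at least one to the degree.\<close>

lemma map_degree_on_ge_2:
  assumes holf: "f holomorphic_on UNIV" and nonconst: "\<not> f constant_on UNIV"
    and d: "map_degree_on f V W d" and ab: "a \<in> V" "b \<in> V" "a \<noteq> b" "f a = f b" "f a \<in> W"
  shows "d \<ge> 2"
proof -
  let ?F = "{z \<in> V. f z = f a}" and ?o = "zorder (\<lambda>u. f u - f a)"
  have fin: "finite ?F" and sum: "sum ?o ?F = int d"
    using d ab(5) unfolding map_degree_on_def by blast+
  have pos: "?o z \<ge> 1" if "z \<in> ?F" for z
    using entire_zorder_pos[OF holf nonconst, of z "f a"] that by simp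
  have "2 \<le> ?o a + ?o b"
    using pos[of a] pos[of b] ab by simp
  also have "\<dots> = sum ?o {a, b}"
    using ab(3) by simp
  also have "\<dots> \<le> sum ?o ?F"
  proof (rule sum_mono2[OF fin])
    show "0 \<le> ?o z" if "z \<in> ?F - {a, b}" for z
      using pos[of z] that by simp
  qed (use ab in auto)
  finally show ?thesis
    using sum by simp
qed

text \<open>The difference quotient \<open>g\<close> at \<open>0\<close> has no zeros by
  injectivity. Points outside the unit disc have values at distance at least \<open>e\<close> from
  \<open>f 0\<close>, so \<open>1 / g\<close> grows at most linearly and is affine by Liouville.
  Having no zeros it is constant, and \<open>f\<close> is affine.\<close>

lemma entire_injective_imp_poly:
  assumes holf: "f holomorphic_on UNIV" and "inj f"
  shows "\<exists>p. \<forall>z. f z = poly p z"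
proof -
  define g where "g z = (if z = 0 then deriv f 0 else (f z - f 0) / z)" for z
  have holg: "g holomorphic_on UNIV"
    unfolding g_def using pole_lemma_open[OF holf open_UNIV, of 0] by (simp only: diff_0_right)
  have g_nz: "g z \<noteq> 0" for z
  proof (cases "z = 0")
    case True
    then show ?thesis
      using holomorphic_injective_imp_regular[OF holf open_UNIV \<open>inj f\<close>] by (simp add: g_def)
  next
    case False
    then show ?thesis
      using \<open>inj f\<close> by (auto simp: g_def inj_eq)
  qed
  have "open (f ` ball 0 1)"
    using open_mapping_thm3[of f "ball 0 1"] holf \<open>inj f\<close>
    by (meson holomorphic_on_subset inj_on_subset open_ball subset_UNIV)
  then obtain e where e: "e > 0" "ball (f 0) e \<subseteq> f ` ball 0 1"
    by (metis centre_in_ball imageI openE zero_less_one)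
  have "norm (1 / g z) \<le> (1 / e) * norm z ^ 1" if z: "1 \<le> norm z" for z
  proof -
    have "f z \<notin> f ` ball 0 1"
      using z \<open>inj f\<close> by (auto simp: inj_eq)
    then have "e \<le> norm (f z - f 0)"
      using e(2) by (force simp: dist_norm norm_minus_commute)
    then show ?thesis
    proof -
      have "norm (1 / g z) = norm z / norm (f z - f 0)"
        using z by (auto simp: g_def norm_divide)
      also have "\<dots> \<le> norm z / e"
        using \<open>e \<le> norm (f z - f 0)\<close> e(1) by (intro frac_le) auto
      finally show ?thesis
        by simp
    qed
  qed
  then have lin: "1 / g z = (\<Sum>k\<le>1. (deriv ^^ k) (\<lambda>z. 1 / g z) 0 / fact k * z ^ k)" for z
    using holg g_nz
    by (intro Liouville_polynomial[where A = 1 and B = "1 / e"]) (auto intro!: holomorphic_intros)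
  define a b where "a = 1 / g 0" and "b = deriv (\<lambda>z. 1 / g z) 0"
  have ab: "1 / g z = a + b * z" for z
    using lin[of z] by (simp add: a_def b_def)
  have "b = 0"
  proof (rule ccontr)
    assume "b \<noteq> 0"
    then have "1 / g (- a / b) = 0"
      by (simp add: ab)
    then show False
      using g_nz by simp
  qed
  then have "1 / g z = a" for z
    using ab[of z] by simp
  then have g_eq: "g z = 1 / a" for z
    by (metis div_by_1 divide_divide_eq_right mult_1)
  have "a \<noteq> 0"
    using g_nz by (simp add: a_def)
  have "f z = f 0 + z / a" for z
    using g_eq[of z] \<open>a \<noteq> 0\<close> by (cases "z = 0") (auto simp: g_def field_simps)
  moreover have "poly [:f 0, 1 / a:] z = f 0 + z / a" for z
    by simp
  ultimately have "f z = poly [:f 0, 1 / a:] z" for z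
    by metis
  then show ?thesis
    by blast
qed

subsection \<open>Strongly polynomial-like functions\<close>

text \<open>Smooths both sides at once: \<open>W\<close> is a sublevel set of a Riemann map, and
  each \<open>V\<close> is a component of a sublevel set of that map composed with \<open>f\<close>.
  Treating every component that meets \<open>D\<close> leaves the choice of a base point
  open.\<close>

lemma exists_smooth_neighbourhood:
  assumes holf: "f holomorphic_on UNIV" and nonconst: "\<not> f constant_on UNIV"
    and D: "domain D" "bounded D" "simply_connected D" and sur: "surrounds (f ` frontier D) (closure D)"
  shows "\<exists>W. bsc_smooth_domain W \<and> closure D \<subseteq> W \<and>
    (\<forall>V \<in> components (f -` W). V \<inter> D \<noteq> {} \<longrightarrow>
        V \<subseteq> D \<and> bsc_smooth_domain V \<and> proper_map_on f V W)"
proof -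
  have contf: "continuous_on A f" for A
    using holf holomorphic_on_imp_continuous_on continuous_on_subset by blast
  have "open D" "connected D" "D \<noteq> {}"
    using D(1) by (auto simp: domain_def)
  have cptD: "compact (closure D)"
    using D(2) by (simp add: compact_closure)

  \<comment> \<open>The simply connected domain bounded by the image curve and its Riemann
    map\<close>
  let ?K = "f ` frontier D"
  obtain \<Omega> where \<Omega>: "\<Omega> \<in> components (- ?K)" "bounded \<Omega>" "closure D \<subseteq> \<Omega>"
    using sur unfolding surrounds_def by blast
  have "compact ?K"
    using D(2) by (intro compact_continuous_image contf) (simp add: compact_frontier_bounded)
  have "connected (frontier D)"
    using simply_connected_eq_frontier_properties[OF \<open>open D\<close>] D(2,3) by auto
  then have "connected ?K"
    by (intro connected_continuous_image contf)
  have "open \<Omega>"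
    using open_components[OF _ \<Omega>(1)] \<open>compact ?K\<close> by (simp add: compact_imp_closed open_Compl)
  have "connected \<Omega>" "connected (- \<Omega>)"
    using in_components_connected[OF \<Omega>(1)] component_complement_connected[OF \<open>connected ?K\<close> \<Omega>(1)] by auto
  then have "simply_connected \<Omega>"
    using simply_connected_iff_simple[OF \<open>open \<Omega>\<close> \<Omega>(2)] by blast
  moreover have "\<Omega> \<noteq> {}" "\<Omega> \<noteq> UNIV"
    using \<Omega>(2,3) \<open>D \<noteq> {}\<close> closure_subset by (auto simp: not_bounded_UNIV)
  ultimately obtain \<phi> \<psi> where hol\<phi>: "\<phi> holomorphic_on \<Omega>" and hol\<psi>: "\<psi> holomorphic_on ball 0 1"
    and \<phi>: "\<And>z. z \<in> \<Omega> \<Longrightarrow> \<phi> z \<in> ball 0 1 \<and> \<psi> (\<phi> z) = z"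
    and \<psi>: "\<And>z. z \<in> ball 0 1 \<Longrightarrow> \<psi> z \<in> \<Omega> \<and> \<phi> (\<psi> z) = z"
    using Riemann_mapping_theorem[of \<Omega>] \<open>open \<Omega>\<close> by blast
  have cont\<phi>: "continuous_on \<Omega> \<phi>" and cont\<psi>: "continuous_on (ball 0 1) \<psi>"
    using hol\<phi> hol\<psi> holomorphic_on_imp_continuous_on by blast+
  have d\<phi>: "deriv \<phi> z \<noteq> 0" if "z \<in> \<Omega>" for z
    using holomorphic_injective_imp_regular[OF hol\<phi> \<open>open \<Omega>\<close> inj_on_inverseI[of _ \<psi>] that] \<phi> by blast

  \<comment> \<open>Choice of a regular level\<close>
  have contn: "continuous_on (closure D) (\<lambda>z. norm (\<phi> z))"
    using cont\<phi> \<Omega>(3) by (intro continuous_on_norm) (rule continuous_on_subset)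
  have "closure D \<noteq> {}"
    using \<open>D \<noteq> {}\<close> by simp
  then obtain x0 where x0: "x0 \<in> closure D" "\<And>z. z \<in> closure D \<Longrightarrow> norm (\<phi> z) \<le> norm (\<phi> x0)"
    using continuous_attains_sup[OF cptD _ contn] by blast
  define Crit where "Crit = {z \<in> closure D. deriv f z = 0}"
  have "finite Crit"
  \<comment> \<open>Finiteness of fibres applies to nonconstant functions only. A constant
    derivative is nonzero, as \<open>f\<close> is not constant, and then there are no critical
    points.\<close>
  proof (cases "deriv f constant_on UNIV")
    case True
    then obtain c where c: "\<And>z. deriv f z = c"
      unfolding constant_on_def by auto
    have "c \<noteq> 0"
    proof
      assume "c = 0"
      then have "(f has_field_derivative 0) (at z)" for z
        using holomorphic_derivI[OF holf open_UNIV, of z] c by simp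
      then have "f constant_on UNIV"
        by (intro has_field_derivative_0_imp_constant_on) auto
      then show False
        using nonconst by contradiction
    qed
    then show ?thesis
      by (simp add: Crit_def c)
  next
    case False
    then show ?thesis
      using entire_finite_fiber[OF _ False cptD, of 0] holomorphic_deriv[OF holf open_UNIV] by (simp add: Crit_def)
  qed
  have "norm (\<phi> x0) < 1"
    using \<phi> x0(1) \<Omega>(3) by auto
  \<comment> \<open>Levels above the maximum \<open>norm (\<phi> x0)\<close> put the closure of
    \<open>D\<close> inside \<open>W\<close>; only finitely many of them are critical.\<close>
  then have "infinite ({norm (\<phi> x0)<..<1} - (\<lambda>z. norm (\<phi> (f z))) ` Crit)"
    using \<open>finite Crit\<close> by (intro Diff_infinite_finite) (auto simp: infinite_Ioo)
  then obtain r where "r \<in> {norm (\<phi> x0)<..<1} - (\<lambda>z. norm (\<phi> (f z))) ` Crit"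
    by (rule infinite_imp_nonempty[THEN ex_in_conv[THEN iffD2], THEN exE])
  then have r: "norm (\<phi> x0) < r" "r < 1" "r \<notin> (\<lambda>z. norm (\<phi> (f z))) ` Crit"
    by simp_all
  have "r > 0"
    using r(1) norm_ge_zero le_less_trans by blast

  \<comment> \<open>The outer domain\<close>
  define W where "W = {z \<in> \<Omega>. norm (\<phi> z) < r}"
  have DW: "closure D \<subseteq> W"
    using x0(2) r(1) \<Omega>(3) by (fastforce simp: W_def)
  have homW: "homeomorphism W (ball 0 r) \<phi> \<psi>"
  proof (rule homeomorphismI)
    show "continuous_on W \<phi>"
      using cont\<phi> by (rule continuous_on_subset) (auto simp: W_def)
    show "continuous_on (ball 0 r) \<psi>"
      using cont\<psi> by (rule continuous_on_subset) (use r(2) in auto)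
  qed (use \<phi> \<psi> r(2) in \<open>auto simp: W_def\<close>)
  then have "W homeomorphic ball (0::complex) r"
    unfolding homeomorphic_def by blast
  then have scW: "simply_connected W"
    using homeomorphic_simply_connected_eq convex_imp_simply_connected convex_ball by blast
  have "connected W"
    using scW simply_connected_imp_connected by blast
  have "W = \<Omega> \<inter> \<phi> -` ball 0 r"
    by (auto simp: W_def)
  then have "open W"
    using continuous_open_preimage[OF cont\<phi> \<open>open \<Omega>\<close> open_ball] by metis
  have "W \<noteq> {}"
    using DW \<open>D \<noteq> {}\<close> closure_subset by blast
  have "W \<subseteq> \<Omega>"
    by (auto simp: W_def)
  then have "bounded W"
    using \<Omega>(2) bounded_subset by blast
  have clW: "closure W \<subseteq> \<Omega>"
  proof -
    have sub: "cball 0 r \<subseteq> ball (0::complex) 1"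
      using r(2) by auto
    have "compact (\<psi> ` cball 0 r)"
      using cont\<psi> sub by (intro compact_continuous_image) (auto intro: continuous_on_subset)
    moreover have "W \<subseteq> \<psi> ` cball 0 r"
    proof
      fix z assume "z \<in> W"
      then show "z \<in> \<psi> ` cball 0 r"
        using \<phi>[of z] by (intro image_eqI[of _ _ "\<phi> z"]) (auto simp: W_def)
    qed
    ultimately have "closure W \<subseteq> \<psi> ` cball 0 r"
      by (intro closure_minimal) (auto simp: compact_imp_closed)
    also have "\<dots> \<subseteq> \<Omega>"
      using \<psi> sub by blast
    finally show ?thesis .
  qed
  have "W \<in> components {z \<in> \<Omega>. norm (\<phi> z) < r}"
    using \<open>connected W\<close> \<open>W \<noteq> {}\<close> in_components_self unfolding W_def by blast
  moreover have "connected (frontier W)"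
    using simply_connected_eq_frontier_properties[OF \<open>open W\<close>] scW \<open>bounded W\<close> by auto
  ultimately have "smooth_boundary W"
    using clW d\<phi> by (intro smooth_boundary_level_component[OF hol\<phi> \<open>open \<Omega>\<close> \<open>r > 0\<close> _ \<open>bounded W\<close> clW])
      (auto simp: frontier_def)
  then have bscW: "bsc_smooth_domain W"
    using \<open>open W\<close> \<open>connected W\<close> \<open>W \<noteq> {}\<close> \<open>bounded W\<close> scW by (simp add: bsc_smooth_domain_def domain_def)

  \<comment> \<open>Components of the preimage\<close>
  have "V \<subseteq> D \<and> bsc_smooth_domain V \<and> proper_map_on f V W"
    if V: "V \<in> components (f -` W)" and VD: "V \<inter> D \<noteq> {}" for V
  proof -
    have VW: "V \<subseteq> f -` W"
      using V by (rule in_components_subset)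
    have "connected V" "V \<noteq> {}"
      using V in_components_connected in_components_nonempty by blast+
    have op: "open (f -` W)"
      using \<open>open W\<close> contf by (simp add: open_vimage)
    then have "open V"
      using V open_components by blast
    have "\<Omega> \<inter> ?K = {}"
      using in_components_subset[OF \<Omega>(1)] by blast
    \<comment> \<open>The frontier of \<open>D\<close> is mapped into \<open>?K\<close>, hence
      outside \<open>W\<close>; so the connected set \<open>V\<close> cannot cross it.\<close>
    then have "V \<inter> frontier D = {}"
      using VW \<open>W \<subseteq> \<Omega>\<close> by blast
    then have "V \<subseteq> D"
      using connected_Int_frontier[OF \<open>connected V\<close> VD] by blast
    then have "bounded V"
      using D(2) bounded_subset by blast
    have clVD: "closure V \<subseteq> closure D"
      using \<open>V \<subseteq> D\<close> by (rule closure_mono)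
    have proper: "proper_map_on f V W"
      by (rule proper_map_on_component_preimage[OF contf \<open>open W\<close> V \<open>bounded V\<close>])
    have scV: "simply_connected V"
      using simply_connected_iff_simple[OF \<open>open W\<close> \<open>bounded W\<close>] scW
      by (intro simply_connected_component_preimage[OF holf nonconst \<open>open W\<close> \<open>bounded W\<close> _ V]) blast
    let ?Q = "f -` \<Omega>"
    have "f ` closure V \<subseteq> closure W"
      using VW closure_subset by (intro image_closure_subset contf) auto
    then have clVQ: "closure V \<subseteq> ?Q"
      using clW by blast
    have "open ?Q"
      using \<open>open \<Omega>\<close> contf by (simp add: open_vimage)
    have holh: "(\<phi> \<circ> f) holomorphic_on ?Q"
      by (intro holomorphic_on_compose_gen[OF holomorphic_on_subset[OF holf] hol\<phi>]) auto
    have VC: "V \<in> components {z \<in> ?Q. norm ((\<phi> \<circ> f) z) < r}"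
    proof -
      have "{z \<in> ?Q. norm ((\<phi> \<circ> f) z) < r} = f -` W"
        by (auto simp: W_def)
      then show ?thesis
        using V by simp
    qed
    have "deriv (\<phi> \<circ> f) z \<noteq> 0" if z: "z \<in> frontier V" for z
    proof -
      have zV: "z \<in> closure V"
        using z by (simp add: frontier_def)
      have "norm (\<phi> (f z)) = r"
        using frontier_component_norm_eq[OF holh \<open>open ?Q\<close> VC clVQ z] by simp
      \<comment> \<open>Here the choice of \<open>r\<close> off the critical levels is used.\<close>
      then have "z \<notin> Crit"
        using r(3) by auto
      then have "deriv f z \<noteq> 0"
        using zV clVD by (auto simp: Crit_def)
      moreover have "f z \<in> \<Omega>"
        using zV clVQ by blast
      moreover have "deriv (\<phi> \<circ> f) z = deriv \<phi> (f z) * deriv f z"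
        using holf hol\<phi> \<open>open \<Omega>\<close> \<open>f z \<in> \<Omega>\<close>
        by (intro deriv_chain) (auto simp: holomorphic_on_imp_differentiable_at)
      ultimately show ?thesis
        using d\<phi> by simp
    qed
    moreover have "connected (frontier V)"
      using simply_connected_eq_frontier_properties[OF \<open>open V\<close>] scV \<open>bounded V\<close> by auto
    ultimately have "smooth_boundary V"
      by (intro smooth_boundary_level_component[OF holh \<open>open ?Q\<close> \<open>r > 0\<close> VC \<open>bounded V\<close> clVQ])
    then show ?thesis
      using \<open>V \<subseteq> D\<close> proper \<open>open V\<close> \<open>connected V\<close> \<open>V \<noteq> {}\<close> \<open>bounded V\<close> scV
      by (simp add: bsc_smooth_domain_def domain_def)
  qed
  then show ?thesis
    using bscW DW by blast
qed

text \<open>Positive degree makes \<open>f\<close> map \<open>V\<close> onto \<open>W\<close>, so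
  the image of the compact closure of \<open>V\<close> covers the closure of \<open>W\<close>. Only
  frontier points can reach the frontier of \<open>W\<close>, so the image of the frontier is
  exactly that of \<open>W\<close>, and \<open>W\<close> is a bounded component of its
  complement.\<close>

lemma polynomial_like_surrounds:
  assumes contf: "continuous_on UNIV f" and pl: "polynomial_like f V W"
  shows "surrounds (f ` frontier V) (closure V)"
proof -
  have V: "open V" "bounded V" and W: "open W" "connected W" "W \<noteq> {}" "bounded W"
    and clV: "closure V \<subseteq> W" and proper: "proper_map_on f V W"
    using pl by (auto simp: polynomial_like_def bsc_smooth_domain_def domain_def)
  obtain d where d: "d \<ge> 2" "map_degree_on f V W d"
    using pl by (auto simp: polynomial_like_def)
  have fr: "f ` frontier V \<subseteq> frontier W"
    using proper_map_on_frontier[OF contf V(1) W(1) proper] by blast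
  have "W \<subseteq> f ` V"
  proof
    fix w assume "w \<in> W"
    then have "(\<Sum>z\<in>{z \<in> V. f z = w}. zorder (\<lambda>u. f u - w) z) = int d"
      using d(2) unfolding map_degree_on_def by blast
    then have "{z \<in> V. f z = w} \<noteq> {}"
      using d(1) by (intro notI) simp
    then show "w \<in> f ` V"
      by blast
  qed
  moreover have fV: "f ` V \<subseteq> W"
    using proper by (simp add: proper_map_on_def)
  moreover have "compact (f ` closure V)"
    using V(2) continuous_on_subset[OF contf] by (intro compact_continuous_image) (auto simp: compact_closure)
  ultimately have "closure W \<subseteq> f ` closure V"
    using closure_subset[of V] by (intro closure_minimal compact_imp_closed) blast+
  then have "closure W \<subseteq> f ` V \<union> f ` frontier V"
    unfolding closure_Un_frontier[of V] image_Un .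
  moreover have "frontier W = closure W - W"
    using W(1) by (simp add: frontier_def interior_open)
  ultimately have "frontier W \<subseteq> f ` frontier V"
    using fV by blast
  then have eq: "f ` frontier V = frontier W"
    using fr by blast
  have "W \<in> components (- frontier W)"
    unfolding in_components_maximal
  proof (intro conjI allI impI)
    show "W \<subseteq> - frontier W"
      using W(1) by (auto simp: frontier_def interior_open)
    fix C assume C: "C \<noteq> {} \<and> W \<subseteq> C \<and> C \<subseteq> - frontier W \<and> connected C"
    then have "C \<subseteq> W"
      using connected_Int_frontier[of C W] W(3) by blast
    then show "C = W"
      using C by blast
  qed (use W in auto)
  then show ?thesis
    unfolding surrounds_def eq using W(4) clV by blast
qed

theorem theorem1p6:
  assumes "transcendental_entire f"
  shows "strongly_polynomial_like f \<longleftrightarrow>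
    (\<exists>D :: nat \<Rightarrow> complex set.
       (\<forall>n. domain (D n) \<and> bounded (D n) \<and> simply_connected (D n)) \<and>
       (\<forall>n. closure (D n) \<subseteq> D (Suc n)) \<and>
       (\<Union>n. D n) = UNIV \<and>
       (\<forall>n. surrounds (f ` frontier (D n)) (closure (D n))))"
proof
  have holf: "f holomorphic_on UNIV" and nopoly: "\<And>p. \<exists>z. f z \<noteq> poly p z"
    using assms by (auto simp: transcendental_entire_def)
  have contf: "continuous_on A f" for A
    using holf holomorphic_on_imp_continuous_on continuous_on_subset by blast

  \<comment> \<open>From polynomial-like restrictions to an exhaustion\<close>
  show "\<exists>D :: nat \<Rightarrow> complex set.
       (\<forall>n. domain (D n) \<and> bounded (D n) \<and> simply_connected (D n)) \<and>
       (\<forall>n. closure (D n) \<subseteq> D (Suc n)) \<and>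
       (\<Union>n. D n) = UNIV \<and>
       (\<forall>n. surrounds (f ` frontier (D n)) (closure (D n)))"
    if spl: "strongly_polynomial_like f"
  proof -
    obtain V W :: "nat \<Rightarrow> complex set" where
      V: "\<And>n. bsc_smooth_domain (V n)" "\<And>n. V n \<subseteq> V (Suc n)" "(\<Union>n. V n) = UNIV"
      and pl: "\<And>n. polynomial_like f (V n) (W n)"
      using spl unfolding strongly_polynomial_like_def by blast
    have Vd: "domain (V n)" "bounded (V n)" "simply_connected (V n)" "open (V n)" for n
      using V(1)[of n] by (auto simp: bsc_smooth_domain_def domain_def)
    have inc: "incseq V"
      using V(2) by (rule incseq_SucI)
    have "\<exists>k. \<forall>j\<ge>k. closure (V n) \<subseteq> V j" for n
    proof -
      obtain k where "closure (V n) \<subseteq> V k"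
        using compact_subset_incseq_open[OF _ Vd(4) inc V(3)] Vd(2) by (metis compact_closure)
      then show ?thesis
        using inc by (meson incseqD subset_trans)
    qed
    \<comment> \<open>The sets \<open>V n\<close> are merely increasing; the subsequence has room
      for closures.\<close>
    then obtain s where s: "strict_mono s" "\<And>n. closure (V (s n)) \<subseteq> V (s (Suc n))"
      using subsequence_choice[of "\<lambda>n j. closure (V n) \<subseteq> V j" 0] by blast
    have "V n \<subseteq> V (s n)" for n
      using incseqD[OF inc strict_mono_imp_increasing[OF s(1)]] .
    then have "(\<Union>n. V n) \<subseteq> (\<Union>n. V (s n))"
      by (rule UN_mono[OF subset_refl])
    then have VU: "(\<Union>n. V (s n)) = UNIV"
      using V(3) by (simp add: top.extremum_unique)
    show ?thesis
      by (intro exI[of _ "\<lambda>n. V (s n)"] conjI allI Vd s(2) VU polynomial_like_surrounds[OF contf pl])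
  qed

  \<comment> \<open>From an exhaustion to polynomial-like restrictions\<close>
  show "strongly_polynomial_like f"
    if exD: "\<exists>D :: nat \<Rightarrow> complex set.
       (\<forall>n. domain (D n) \<and> bounded (D n) \<and> simply_connected (D n)) \<and>
       (\<forall>n. closure (D n) \<subseteq> D (Suc n)) \<and>
       (\<Union>n. D n) = UNIV \<and>
       (\<forall>n. surrounds (f ` frontier (D n)) (closure (D n)))"
  proof -
    obtain D :: "nat \<Rightarrow> complex set" where
      D: "\<And>n. domain (D n)" "\<And>n. bounded (D n)" "\<And>n. simply_connected (D n)"
        "\<And>n. closure (D n) \<subseteq> D (Suc n)" "(\<Union>n. D n) = UNIV"
        "\<And>n. surrounds (f ` frontier (D n)) (closure (D n))"
      using exD by blast
    have nonconst: "\<not> f constant_on UNIV"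
    proof
      assume "f constant_on UNIV"
      then obtain c where "\<And>z. f z = poly [:c:] z"
        unfolding constant_on_def by auto
      then show False
        using nopoly by blast
    qed
    \<comment> \<open>An injective entire function is a polynomial. The pair \<open>a\<close>,
      \<open>b\<close> with a common value will force degree at least two.\<close>
    obtain a b where ab: "a \<noteq> b" "f a = f b"
      using entire_injective_imp_poly[OF holf] nopoly unfolding inj_def by blast
    have inc: "incseq D"
      using D(4) closure_subset by (intro incseq_SucI) blast
    have "open (D n)" for n
      using D(1) by (simp add: domain_def)
    then have cover: "\<exists>m. \<forall>n\<ge>m. K \<subseteq> D n" if "compact K" for K
      using compact_subset_incseq_open[OF that _ inc D(5)] incseqD[OF inc] by (meson subset_trans)
    obtain W where W: "\<And>n. bsc_smooth_domain (W n)" "\<And>n. closure (D n) \<subseteq> W n"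
      and WV: "\<And>n V. V \<in> components (f -` W n) \<Longrightarrow> V \<inter> D n \<noteq> {} \<Longrightarrow>
          V \<subseteq> D n \<and> bsc_smooth_domain V \<and> proper_map_on f V (W n)"
      using exists_smooth_neighbourhood[OF holf nonconst D(1-3,6)] by metis
    have Wd: "open (W n)" "connected (W n)" "bounded (W n)" for n
      using W(1)[of n] by (auto simp: bsc_smooth_domain_def domain_def)
    have DW: "D n \<subseteq> W n" for n
      using W(2) closure_subset by blast
    \<comment> \<open>A disc joins \<open>0\<close>, \<open>a\<close> and \<open>b\<close>, so a
      component of a preimage that contains \<open>0\<close> and swallows the disc contains both
      points.\<close>
    define B where "B = cball (0::complex) (max (norm a) (norm b))"
    have B: "compact B" "connected B" "0 \<in> B" "a \<in> B" "b \<in> B"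
      unfolding B_def by (auto simp: le_max_iff_disj)
    obtain m where m: "\<And>n. n \<ge> m \<Longrightarrow> B \<union> f ` B \<subseteq> D n"
      using cover[of "B \<union> f ` B"] B(1) contf compact_continuous_image by blast
    have "\<exists>k. \<forall>j\<ge>k. W n \<subseteq> D j" for n
      using cover[of "closure (W n)"] Wd(3) closure_subset by (metis compact_closure subset_trans)
    \<comment> \<open>The spacing makes the sets \<open>W (s n)\<close> increasing, and the start at
      \<open>m\<close> keeps \<open>B\<close> and its image inside every
      \<open>D (s n)\<close>.\<close>
    then obtain s where s: "strict_mono s" "m \<le> s 0" and sW: "\<And>n. W (s n) \<subseteq> D (s (Suc n))"
      using subsequence_choice[of "\<lambda>n j. W n \<subseteq> D j" m] by blast
    have sm: "m \<le> s n" for n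
      using s(2) strict_mono_leD[OF s(1), of 0 n] by simp
    have sn: "n \<le> s n" for n
      using strict_mono_imp_increasing[OF s(1)] .
    \<comment> \<open>The common base point \<open>0\<close> makes these components increase with
      \<open>W (s n)\<close>.\<close>
    define V where "V n = connected_component_set (f -` W (s n)) 0" for n
    have zero: "0 \<in> f -` W (s n)" for n
      using m[OF sm[of n]] B(3) DW[of "s n"] by blast
    then have VC: "V n \<in> components (f -` W (s n))" and zV: "0 \<in> V n" for n
      unfolding V_def by (auto intro: componentsI)
    have "V n \<inter> D (s n) \<noteq> {}" for n
      using zV m[OF sm[of n]] B(3) by blast
    then have VD: "V n \<subseteq> D (s n)" and bscV: "bsc_smooth_domain (V n)" and proper: "proper_map_on f (V n) (W (s n))" for n
      using WV[OF VC] by blast+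
    have Vmax: "C \<subseteq> V n" if "connected C" "0 \<in> C" "f ` C \<subseteq> D (s n)" for C n
      unfolding V_def using that DW[of "s n"] by (intro connected_component_maximal) auto
    have Winc: "W (s n) \<subseteq> W (s (Suc n))" for n
      using sW DW by blast
    have Vinc: "V n \<subseteq> V (Suc n)" for n
      unfolding V_def using Winc by (intro connected_component_mono) blast
    have "z \<in> (\<Union>n. V n)" for z
    proof -
      \<comment> \<open>The disc reaching \<open>z\<close> is connected and contains
        \<open>0\<close>; once its compact image lies in \<open>D (s k)\<close>, it lies in the
        component of \<open>0\<close>.\<close>
      obtain k where "f ` cball 0 (norm z) \<subseteq> D (s k)"
        using cover[of "f ` cball 0 (norm z)"] sn contf compact_continuous_image compact_cball by metis
      then have "cball 0 (norm z) \<subseteq> V k"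
        by (intro Vmax) auto
      then show ?thesis
        by (auto simp: subset_iff)
    qed
    then have VU: "(\<Union>n. V n) = UNIV"
      by blast
    have "D n \<subseteq> W (s n)" for n
      using incseqD[OF inc sn] DW by blast
    then have "(\<Union>n. D n) \<subseteq> (\<Union>n. W (s n))"
      by (rule UN_mono[OF subset_refl])
    then have WU: "(\<Union>n. W (s n)) = UNIV"
      using D(5) by (simp add: top.extremum_unique)
    have "polynomial_like f (V n) (W (s n))" for n
    proof -
      have Vn: "open (V n)" "connected (V n)" "bounded (V n)" "V n \<noteq> {}" "smooth_boundary (V n)"
        using bscV[of n] by (auto simp: bsc_smooth_domain_def domain_def)
      obtain d where d: "map_degree_on f (V n) (W (s n)) d"
        using proper_map_degree[OF holf nonconst Vn Wd(1,2) proper] by blast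
      have BV: "B \<subseteq> V n"
        using m[OF sm[of n]] B by (intro Vmax) auto
      then have "f a \<in> W (s n)"
        using proper[of n] B(4) by (auto simp: proper_map_on_def)
      then have "d \<ge> 2"
        using map_degree_on_ge_2[OF holf nonconst d _ _ ab] BV B(4,5) by blast
      moreover have "closure (V n) \<subseteq> W (s n)"
        using closure_mono[OF VD] W(2) by blast
      moreover have "f holomorphic_on V n"
        using holf holomorphic_on_subset by blast
      ultimately show ?thesis
        unfolding polynomial_like_def using bscV W(1) proper d by blast
    qed
    then show ?thesis
      unfolding strongly_polynomial_like_def
      by (intro exI[of _ V] exI[of _ "\<lambda>n. W (s n)"] conjI allI bscV W(1) Vinc Winc VU WU)
  qed
qed

end
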